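(* The reachability problem for TSO games with update fairness is undecidable: there is no algorithm that, given a concurrent program $\mathcal{P}$, a set $F$ of local states and an initial TSO configuration $c_0$, decides whether the process player wins the TSO game $\mathcal{G}(\mathcal{P})$ from $(c_0)_A$ with respect to the winning condition $W_{RU}=W_R\cup\overline{W_U}$.
   Context: Let $V$ be a finite data domain and $X$ a finite set of shared variables over $V$. Instructions are $\mathrm{rd}(x,d)$, $\mathrm{wr}(x,d)$ ($x\in X,d\in V$), $\mathrm{skip}$, $\mathrm{mf}$. A process is a finite labelled transition system $\langle Q,\mathrm{Instrs},\delta\rangle$; a concurrent program is a tuple $\mathcal{P}=\langle P^\iota\rangle_{\iota\in I}$, $I$ finite. A TSO configuration is $c=\langle s,b,m\rangle$ with $s(\iota)\in Q^\iota$, FIFO buffers $b(\iota)\in(X\times V)^*$ (new messages on the left, oldest on the right), memory $m:X\to V$. TSO transitions: $\mathrm{rd}(x,d)$ of process $\iota$ is enabled if the most recent message on $x$ in $b(\iota)$ is $\langle x,d\rangle$, or if $b(\iota)$ has no message on $x$ and $m(x)=d$; $\mathrm{wr}(x,d)$ prepends $\langle x,d\rangle$ to $b(\iota)$; $\mathrm{skip}$ changes only the local state; $\mathrm{mf}$ is enabled only if $b(\iota)=\varepsilon$; an update of $\iota$ removes the oldest message $\langle x,d\rangle$ from $b(\iota)$ and sets $m(x)=d$. A game $\langle C,C_A,C_B,\to\rangle$: a play is an infinite sequence of moves, or a finite one ending in a configuration with no successors; a winning condition is a set of plays; player A wins an infinite play in the winning condition or a finite play ending in $C_B$; otherwise B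 wins; a configuration is winning for A if A has a strategy winning against every strategy of B. The TSO game $\mathcal{G}(\mathcal{P})$: $C_A,C_B$ are copies of the TSO configurations; the process player (A) moves $c_A\to c'_B$ along any instruction transition of any process; the update player (B) moves $c_B\to c'_A$ for every $c'$ obtained from $c$ by zero or more updates. For a set $F$ of local states, $C_F$ is the set of game configurations where some process is in a state of $F$; $W_R$ is the set of plays visiting $C_F$ (it is assumed no process can deadlock from a target state, and $c_0\notin C_F$). Update fairness: $W_U$ is the set of plays $c_0,c_1,\dots$ such that for all $k$ with $c_k\in C_A$, if $c_k$ has no successor then all buffers of $c_k$ are empty. $\overline{W_U}$ is the set of plays not in $W_U$.
   Formalization: The rule for finite plays is corrected: the process player also wins finite plays that lie in the winning condition; under the literal rule all plays violating update fairness (finite, ending in C_A) would be lost by A, and the complement of W_U would have no effect. *)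

theory Defs
  imports Main "HOL-Library.Nat_Bijection"
begin

section \<open>Concurrent programs and their TSO semantics\<close>

datatype ('x, 'v) instr = Rd 'x 'v | Wr 'x 'v | Skip | Mf

definition instrs :: "'x set \<Rightarrow> 'v set \<Rightarrow> ('x, 'v) instr set" where
  "instrs X V = {Rd x d | x d. x \<in> X \<and> d \<in> V} \<union> {Wr x d | x d. x \<in> X \<and> d \<in> V} \<union> {Skip, Mf}"

record ('i, 'q, 'x, 'v) program =
  vars :: "'x set"
  vals :: "'v set"
  procs :: "'i set"
  states :: "'i \<Rightarrow> 'q set"
  trans_rel :: "'i \<Rightarrow> ('q \<times> ('x, 'v) instr \<times> 'q) set"

definition program :: "('i, 'q, 'x, 'v) program \<Rightarrow> bool" where
  "program P \<longleftrightarrow> finite (vars P) \<and> finite (vals P) \<and> finite (procs P) \<and>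
     (\<forall>i\<in>procs P. finite (states P i) \<and>
        trans_rel P i \<subseteq> states P i \<times> instrs (vars P) (vals P) \<times> states P i)"

text \<open>The head of a buffer list is its newest message, the last element its oldest one.\<close>

record ('i, 'q, 'x, 'v) config =
  st :: "'i \<Rightarrow> 'q"
  buf :: "'i \<Rightarrow> ('x \<times> 'v) list"
  mem :: "'x \<Rightarrow> 'v"

text \<open>Values of the three components outside \<open>procs P\<close> and \<open>vars P\<close> are unconstrained; no
  transition reads or changes them.\<close>

definition configs :: "('i, 'q, 'x, 'v) program \<Rightarrow> ('i, 'q, 'x, 'v) config set" where
  "configs P = {c. (\<forall>i\<in>procs P. st c i \<in> states P i \<and> set (buf c i) \<subseteq> vars P \<times> vals P) \<and>
     (\<forall>x\<in>vars P. mem c x \<in> vals P)}"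

text \<open>\<open>map_of\<close> returns the leftmost, hence the most recent, message on a variable.\<close>

definition read_value :: "('i, 'q, 'x, 'v) config \<Rightarrow> 'i \<Rightarrow> 'x \<Rightarrow> 'v" where
  "read_value c i x = (case map_of (buf c i) x of Some d \<Rightarrow> d | None \<Rightarrow> mem c x)"

inductive instr_step ::
  "('i, 'q, 'x, 'v) program \<Rightarrow> 'i \<Rightarrow> ('i, 'q, 'x, 'v) config \<Rightarrow> ('i, 'q, 'x, 'v) config \<Rightarrow> bool"
  for P i c where
  rd: "\<lbrakk>i \<in> procs P; (st c i, Rd x d, q) \<in> trans_rel P i; read_value c i x = d\<rbrakk>
    \<Longrightarrow> instr_step P i c (c\<lparr>st := (st c)(i := q)\<rparr>)"
| wr: "\<lbrakk>i \<in> procs P; (st c i, Wr x d, q) \<in> trans_rel P i\<rbrakk>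
    \<Longrightarrow> instr_step P i c (c\<lparr>st := (st c)(i := q), buf := (buf c)(i := (x, d) # buf c i)\<rparr>)"
| skip: "\<lbrakk>i \<in> procs P; (st c i, Skip, q) \<in> trans_rel P i\<rbrakk>
    \<Longrightarrow> instr_step P i c (c\<lparr>st := (st c)(i := q)\<rparr>)"
| mf: "\<lbrakk>i \<in> procs P; (st c i, Mf, q) \<in> trans_rel P i; buf c i = []\<rbrakk>
    \<Longrightarrow> instr_step P i c (c\<lparr>st := (st c)(i := q)\<rparr>)"

inductive update_step ::
  "('i, 'q, 'x, 'v) program \<Rightarrow> ('i, 'q, 'x, 'v) config \<Rightarrow> ('i, 'q, 'x, 'v) config \<Rightarrow> bool"
  for P c where
  "\<lbrakk>i \<in> procs P; buf c i = b @ [(x, d)]\<rbrakk>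
    \<Longrightarrow> update_step P c (c\<lparr>buf := (buf c)(i := b), mem := (mem c)(x := d)\<rparr>)"

definition tso_step ::
  "('i, 'q, 'x, 'v) program \<Rightarrow> ('i, 'q, 'x, 'v) config \<Rightarrow> ('i, 'q, 'x, 'v) config \<Rightarrow> bool" where
  "tso_step P c c' \<longleftrightarrow> (\<exists>i. instr_step P i c c') \<or> update_step P c c'"


section \<open>Games\<close>

record 'g game =
  conf_A :: "'g set"
  conf_B :: "'g set"
  move :: "'g \<Rightarrow> 'g \<Rightarrow> bool"

definition no_succ :: "'g game \<Rightarrow> 'g \<Rightarrow> bool" where
  "no_succ G g \<longleftrightarrow> (\<nexists>g'. move G g g')"

datatype 'g play = Finite "'g list" | Infinite "nat \<Rightarrow> 'g"

definition plays :: "'g game \<Rightarrow> 'g play set" where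
  "plays G =
     {Infinite f | f. range f \<subseteq> conf_A G \<union> conf_B G \<and> (\<forall>n. move G (f n) (f (Suc n)))} \<union>
     {Finite h | h. h \<noteq> [] \<and> set h \<subseteq> conf_A G \<union> conf_B G \<and> successively (move G) h \<and>
        no_succ G (last h)}"

fun visited :: "'g play \<Rightarrow> 'g set" where
  "visited (Finite h) = set h"
| "visited (Infinite f) = range f"

text \<open>A player who cannot move loses, unless the winning condition itself awards the finite play
  to player A. The plays violating update fairness below are exactly of the latter kind: they are
  finite and end in a configuration of player A.\<close>

fun won_by_A :: "'g game \<Rightarrow> 'g play set \<Rightarrow> 'g play \<Rightarrow> bool" where
  "won_by_A G W (Infinite f) \<longleftrightarrow> Infinite f \<in> W"
| "won_by_A G W (Finite h) \<longleftrightarrow> last h \<in> conf_B G \<or> Finite h \<in> W"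

text \<open>A strategy maps the history of the play to the next configuration. Its value is irrelevant
  on histories that do not end in a nonterminal configuration of the player.\<close>

definition strategy :: "'g game \<Rightarrow> 'g set \<Rightarrow> ('g list \<Rightarrow> 'g) \<Rightarrow> bool" where
  "strategy G D \<sigma> \<longleftrightarrow>
     (\<forall>h. h \<noteq> [] \<and> last h \<in> D \<and> \<not> no_succ G (last h) \<longrightarrow> move G (last h) (\<sigma> h))"

fun history :: "'g game \<Rightarrow> ('g list \<Rightarrow> 'g) \<Rightarrow> ('g list \<Rightarrow> 'g) \<Rightarrow> 'g \<Rightarrow> nat \<Rightarrow> 'g list" where
  "history G \<sigma> \<tau> g 0 = [g]"
| "history G \<sigma> \<tau> g (Suc n) =
     (let h = history G \<sigma> \<tau> g n in h @ [if last h \<in> conf_A G then \<sigma> h else \<tau> h])"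

definition outcome :: "'g game \<Rightarrow> ('g list \<Rightarrow> 'g) \<Rightarrow> ('g list \<Rightarrow> 'g) \<Rightarrow> 'g \<Rightarrow> 'g play" where
  "outcome G \<sigma> \<tau> g =
     (if \<exists>n. no_succ G (last (history G \<sigma> \<tau> g n))
      then Finite (history G \<sigma> \<tau> g (LEAST n. no_succ G (last (history G \<sigma> \<tau> g n))))
      else Infinite (\<lambda>n. last (history G \<sigma> \<tau> g n)))"

definition winning_for_A :: "'g game \<Rightarrow> 'g play set \<Rightarrow> 'g \<Rightarrow> bool" where
  "winning_for_A G W g \<longleftrightarrow>
     (\<exists>\<sigma>. strategy G (conf_A G) \<sigma> \<and>
        (\<forall>\<tau>. strategy G (conf_B G) \<tau> \<longrightarrow> won_by_A G W (outcome G \<sigma> \<tau> g)))"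


section \<open>TSO games\<close>

datatype 'c copy = Turn_A (conf: 'c) | Turn_B (conf: 'c)

inductive tso_move :: "('i, 'q, 'x, 'v) program \<Rightarrow>
    ('i, 'q, 'x, 'v) config copy \<Rightarrow> ('i, 'q, 'x, 'v) config copy \<Rightarrow> bool"
  for P where
  process: "instr_step P i c c' \<Longrightarrow> tso_move P (Turn_A c) (Turn_B c')"
| update: "(update_step P)\<^sup>*\<^sup>* c c' \<Longrightarrow> tso_move P (Turn_B c) (Turn_A c')"

definition tso_game :: "('i, 'q, 'x, 'v) program \<Rightarrow> ('i, 'q, 'x, 'v) config copy game" where
  "tso_game P = \<lparr>conf_A = Turn_A ` configs P, conf_B = Turn_B ` configs P, move = tso_move P\<rparr>"

definition in_target :: "('i, 'q, 'x, 'v) program \<Rightarrow> 'q set \<Rightarrow> ('i, 'q, 'x, 'v) config \<Rightarrow> bool" where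
  "in_target P F c \<longleftrightarrow> (\<exists>i\<in>procs P. st c i \<in> F)"

definition target_confs ::
  "('i, 'q, 'x, 'v) program \<Rightarrow> 'q set \<Rightarrow> ('i, 'q, 'x, 'v) config copy set" where
  "target_confs P F = {g \<in> conf_A (tso_game P) \<union> conf_B (tso_game P). in_target P F (conf g)}"

definition W_R ::
  "('i, 'q, 'x, 'v) program \<Rightarrow> 'q set \<Rightarrow> ('i, 'q, 'x, 'v) config copy play set" where
  "W_R P F = {p \<in> plays (tso_game P). visited p \<inter> target_confs P F \<noteq> {}}"

definition W_U :: "('i, 'q, 'x, 'v) program \<Rightarrow> ('i, 'q, 'x, 'v) config copy play set" where
  "W_U P = {p \<in> plays (tso_game P). \<forall>g \<in> visited p \<inter> conf_A (tso_game P).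
     no_succ (tso_game P) g \<longrightarrow> (\<forall>i\<in>procs P. buf (conf g) i = [])}"

definition W_RU ::
  "('i, 'q, 'x, 'v) program \<Rightarrow> 'q set \<Rightarrow> ('i, 'q, 'x, 'v) config copy play set" where
  "W_RU P F = W_R P F \<union> (plays (tso_game P) - W_U P)"

text \<open>A process that is in a target state never again reaches a configuration in which it has no
  enabled instruction. In particular, every play that visits a target configuration is infinite.\<close>

definition no_deadlock_from_target :: "('i, 'q, 'x, 'v) program \<Rightarrow> 'q set \<Rightarrow> bool" where
  "no_deadlock_from_target P F \<longleftrightarrow>
     (\<forall>c\<in>configs P. \<forall>i\<in>procs P. st c i \<in> F \<longrightarrow>
        (\<forall>c'. (tso_step P)\<^sup>*\<^sup>* c c' \<longrightarrow> (\<exists>c''. instr_step P i c' c'')))"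


section \<open>Problem instances and their encoding\<close>

text \<open>Finite presentations: variables, values and process indices are initial segments of the
  natural numbers, local states arbitrary natural numbers (so the state sets of different processes
  may overlap or be disjoint). Finite sets and functions on initial segments are given as lists.\<close>

record tso_instance =
  n_vars :: nat
  n_vals :: nat
  proc_list :: "(nat list \<times> (nat \<times> (nat, nat) instr \<times> nat) list) list"
  target_list :: "nat list"
  init_st :: "nat list"
  init_buf :: "(nat \<times> nat) list list"
  init_mem :: "nat list"

definition program_of :: "tso_instance \<Rightarrow> (nat, nat, nat, nat) program" where
  "program_of a = \<lparr>vars = {..<n_vars a}, vals = {..<n_vals a}, procs = {..<length (proc_list a)},
     states = (\<lambda>i. set (fst (proc_list a ! i))), trans_rel = (\<lambda>i. set (snd (proc_list a ! i)))\<rparr>"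

definition targets_of :: "tso_instance \<Rightarrow> nat set" where
  "targets_of a = set (target_list a)"

definition init_of :: "tso_instance \<Rightarrow> (nat, nat, nat, nat) config" where
  "init_of a = \<lparr>st = (!) (init_st a), buf = (!) (init_buf a), mem = (!) (init_mem a)\<rparr>"

definition valid_instance :: "tso_instance \<Rightarrow> bool" where
  "valid_instance a \<longleftrightarrow>
     length (init_st a) = length (proc_list a) \<and> length (init_buf a) = length (proc_list a) \<and>
     length (init_mem a) = n_vars a \<and>
     program (program_of a) \<and> init_of a \<in> configs (program_of a) \<and>
     targets_of a \<subseteq> (\<Union>i\<in>procs (program_of a). states (program_of a) i) \<and>
     \<not> in_target (program_of a) (targets_of a) (init_of a) \<and>
     no_deadlock_from_target (program_of a) (targets_of a)"

fun code_instr :: "(nat, nat) instr \<Rightarrow> nat" where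
  "code_instr (Rd x d) = list_encode [0, x, d]"
| "code_instr (Wr x d) = list_encode [1, x, d]"
| "code_instr Skip = list_encode [2]"
| "code_instr Mf = list_encode [3]"

fun code_trans :: "nat \<times> (nat, nat) instr \<times> nat \<Rightarrow> nat" where
  "code_trans (q, ins, q') = list_encode [q, code_instr ins, q']"

fun code_process :: "nat list \<times> (nat \<times> (nat, nat) instr \<times> nat) list \<Rightarrow> nat" where
  "code_process (Q, \<delta>) = list_encode [list_encode Q, list_encode (map code_trans \<delta>)]"

definition code_instance :: "tso_instance \<Rightarrow> nat" where
  "code_instance a = list_encode
     [n_vars a, n_vals a,
      list_encode (map code_process (proc_list a)),
      list_encode (target_list a),
      list_encode (init_st a),
      list_encode (map (\<lambda>b. list_encode (map prod_encode b)) (init_buf a)),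
      list_encode (init_mem a)]"


section \<open>Algorithms: partial recursive functions\<close>

datatype recf = Zero | Succ | Proj nat | Comp recf "recf list" | PrimRec recf recf | Mu recf

text \<open>\<open>computes f xs y\<close>: the partial recursive function \<open>f\<close> is defined on the arguments \<open>xs\<close>, with
  value \<open>y\<close>.\<close>

inductive computes :: "recf \<Rightarrow> nat list \<Rightarrow> nat \<Rightarrow> bool" where
  "computes Zero xs 0"
| "computes Succ [n] (Suc n)"
| "k < length xs \<Longrightarrow> computes (Proj k) xs (xs ! k)"
| "\<lbrakk>list_all2 (\<lambda>g y. computes g xs y) gs ys; computes f ys z\<rbrakk> \<Longrightarrow> computes (Comp f gs) xs z"
| "computes f xs y \<Longrightarrow> computes (PrimRec f g) (0 # xs) y"
| "\<lbrakk>computes (PrimRec f g) (n # xs) r; computes g (n # r # xs) y\<rbrakk>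
    \<Longrightarrow> computes (PrimRec f g) (Suc n # xs) y"
| "\<lbrakk>computes f (n # xs) 0; \<forall>k<n. \<exists>r. computes f (k # xs) (Suc r)\<rbrakk> \<Longrightarrow> computes (Mu f) xs n"

text \<open>The algorithm only has to halt, with the correct answer, on inputs from \<open>D\<close>.\<close>

definition decidable_on :: "('a \<Rightarrow> nat) \<Rightarrow> 'a set \<Rightarrow> ('a \<Rightarrow> bool) \<Rightarrow> bool" where
  "decidable_on code D R \<longleftrightarrow> (\<exists>f. \<forall>a\<in>D. computes f [code a] (if R a then 1 else 0))"

end

theory Submission
  imports Defs "HOL-Library.Multiset"
begin

text \<open>A queue machine is simulated by two processes. The buffer of the writer holds the queue. The
  relay waits for the next message, resets its variable, forwards the value to the writer through a
  third variable and passes a fence. Messages alternate between two variables, so an update player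
  who delivers two messages before the first one is reset leaves traces in both variables, and the
  relay can react by moving to the target. An update player who delivers too few messages leaves the
  process player stuck with a nonempty buffer and loses by update fairness. Conversely, an update
  player who delivers messages only when the process player is stuck forces a faithful simulation,
  whatever the process player does.

  Queue machines simulate counter machines, and these the partial recursive functions. The code of a
  program serves as its own input, which occurs in the instance only as the initial buffer and as the
  bound on the values. So a decision procedure for the game composed with the computable map from
  program codes to instances yields a program that contradicts it.\<close>

section \<open>Strategies in TSO games\<close>

text \<open>The relay is there because a process reads its own pending messages first: while the
  writer has messages on the two queue variables, it cannot see what has reached memory. So it reads
  only the third variable, which it never writes. A premature delivery leaves a lasting trace since
  all queued values are nonzero and only the relay writes zero, to the variable of the message it
  has just received. The fence closes the round: a blocked writer and a fenced relay are stuck until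
  the reset and the forwarded value are both in memory.

  Each letter becomes two messages, the letter and a separator of value 1. The separator tells two
  equal letters in a row apart and makes every letter start on the same variable.

  The two directions need different invariants. The process player picks the schedule, so one finite
  run suffices, and the freedom of the update player is absorbed into predicates stable under
  updates. The update player faces arbitrary interleavings of writer and relay; they are harmless
  because it delivers only while the writer is blocked.\<close>

lemma history_last:
  "history G \<sigma> \<tau> g n = map (\<lambda>k. last (history G \<sigma> \<tau> g k)) [0..<Suc n]"
proof (induction n)
  case 0
  show ?case by simp
next
  case (Suc n)
  have "history G \<sigma> \<tau> g (Suc n) =
      history G \<sigma> \<tau> g n @ [last (history G \<sigma> \<tau> g (Suc n))]"
    by (simp add: Let_def)
  also have "\<dots> = map (\<lambda>k. last (history G \<sigma> \<tau> g k)) ([0..<Suc n] @ [Suc n])"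
    by (subst Suc) (simp del: history.simps)
  finally show ?case by simp
qed

lemma history_nonempty [simp]: "history G \<sigma> \<tau> g n \<noteq> []"
  by (cases n) (simp_all add: Let_def)

lemma last_history_Suc:
  "last (history G \<sigma> \<tau> g (Suc n)) =
     (if last (history G \<sigma> \<tau> g n) \<in> conf_A G then \<sigma> (history G \<sigma> \<tau> g n) else \<tau> (history G \<sigma> \<tau> g n))"
  by (simp add: Let_def)

locale strategies =
  fixes G :: "'g game" and \<sigma> \<tau> :: "'g list \<Rightarrow> 'g" and g :: 'g
  assumes A: "strategy G (conf_A G) \<sigma>" and B: "strategy G (conf_B G) \<tau>"
    and start: "g \<in> conf_A G \<union> conf_B G"
    and closed: "\<And>x y. x \<in> conf_A G \<union> conf_B G \<Longrightarrow> move G x y \<Longrightarrow> y \<in> conf_A G \<union> conf_B G"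
begin

abbreviation "pos n \<equiv> last (history G \<sigma> \<tau> g n)"

lemma pos_move:
  assumes "pos n \<in> conf_A G \<union> conf_B G" "\<not> no_succ G (pos n)"
  shows "move G (pos n) (pos (Suc n))"
  using A B assms unfolding strategy_def last_history_Suc by auto

lemma pos_conf:
  assumes "\<And>j. j < n \<Longrightarrow> \<not> no_succ G (pos j)"
  shows "pos n \<in> conf_A G \<union> conf_B G"
  using assms
proof (induction n)
  case 0
  then show ?case using start by simp
next
  case (Suc n)
  then have "pos n \<in> conf_A G \<union> conf_B G" by simp
  moreover have "\<not> no_succ G (pos n)" using Suc.prems by blast
  ultimately show ?case using pos_move closed by blast
qed

lemma outcome_cases:
  obtains (finite) n where "no_succ G (pos n)" "\<And>j. j < n \<Longrightarrow> \<not> no_succ G (pos j)"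
    "outcome G \<sigma> \<tau> g = Finite (map pos [0..<Suc n])"
  | (infinite) "\<And>n. \<not> no_succ G (pos n)" "outcome G \<sigma> \<tau> g = Infinite pos"
proof (cases "\<exists>n. no_succ G (pos n)")
  case True
  define n where "n = (LEAST n. no_succ G (pos n))"
  have "no_succ G (pos n)" unfolding n_def by (rule LeastI_ex[OF True])
  moreover have "\<And>j. j < n \<Longrightarrow> \<not> no_succ G (pos j)" unfolding n_def by (rule not_less_Least)
  moreover have "outcome G \<sigma> \<tau> g = Finite (map pos [0..<Suc n])"
    using True history_last[of G \<sigma> \<tau> g n] unfolding outcome_def n_def by auto
  ultimately show ?thesis by (rule finite)
next
  case False
  then show ?thesis using infinite unfolding outcome_def by auto
qed

lemma outcome_plays: "outcome G \<sigma> \<tau> g \<in> plays G"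
proof (cases rule: outcome_cases)
  case (finite n)
  have conf: "pos k \<in> conf_A G \<union> conf_B G" if "k \<le> n" for k
    using that finite(2) pos_conf by auto
  have "successively (move G) (map pos [0..<Suc n])"
    unfolding successively_conv_nth
  proof (intro allI impI)
    fix i
    assume i: "Suc i < length (map pos [0..<Suc n])"
    then have "move G (pos i) (pos (Suc i))"
      using finite(2) conf by (intro pos_move) auto
    then show "move G (map pos [0..<Suc n] ! i) (map pos [0..<Suc n] ! Suc i)"
      using i by (simp del: upt_Suc history.simps)
  qed
  moreover have "set (map pos [0..<Suc n]) \<subseteq> conf_A G \<union> conf_B G"
  proof -
    have "\<exists>k\<le>n. x = pos k" if "x \<in> set (map pos [0..<Suc n])" for x
      using that less_Suc_eq_le by (auto simp del: upt_Suc history.simps)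
    then show ?thesis using conf by (metis subsetI)
  qed
  moreover have "no_succ G (last (map pos [0..<Suc n]))" using finite(1) by simp
  moreover have "map pos [0..<Suc n] \<noteq> []" by simp
  ultimately show ?thesis unfolding finite(3) plays_def by blast
next
  case infinite
  have "pos n \<in> conf_A G \<union> conf_B G" for n using infinite(1) pos_conf by blast
  then show ?thesis using pos_move infinite unfolding infinite(2) plays_def by blast
qed

lemma visited_outcome:
  assumes "\<And>j. j < n \<Longrightarrow> \<not> no_succ G (pos j)"
  shows "pos n \<in> visited (outcome G \<sigma> \<tau> g)"
proof (cases rule: outcome_cases)
  case (finite m)
  then have "n \<le> m" using assms by (meson not_le)
  then show ?thesis unfolding finite(3) by (simp add: image_iff del: upt_Suc history.simps) force
next
  case infinite
  then show ?thesis by simp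
qed

end

section \<open>Moves of the TSO game\<close>

lemma instr_step_configs:
  assumes "program P" "c \<in> configs P" "instr_step P i c c'"
  shows "c' \<in> configs P"
  using assms(3)
proof cases
  case (rd x d q)
  then have "q \<in> states P i" using assms(1) unfolding program_def by blast
  then show ?thesis using assms(2) rd unfolding configs_def by auto
next
  case (wr x d q)
  then have "q \<in> states P i" "Wr x d \<in> instrs (vars P) (vals P)"
    using assms(1) unfolding program_def by blast+
  then have "q \<in> states P i" "x \<in> vars P" "d \<in> vals P" unfolding instrs_def by auto
  then show ?thesis using assms(2) wr unfolding configs_def by auto
next
  case (skip q)
  then have "q \<in> states P i" using assms(1) unfolding program_def by blast
  then show ?thesis using assms(2) skip unfolding configs_def by auto
next
  case (mf q)
  then have "q \<in> states P i" using assms(1) unfolding program_def by blast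
  then show ?thesis using assms(2) mf unfolding configs_def by auto
qed

lemma update_step_configs:
  assumes "c \<in> configs P" "update_step P c c'"
  shows "c' \<in> configs P"
  using assms(2)
proof cases
  case (1 i b x d)
  have "set (buf c i) \<subseteq> vars P \<times> vals P" using assms(1) 1 unfolding configs_def by blast
  then have "set b \<subseteq> vars P \<times> vals P" "x \<in> vars P" "d \<in> vals P" using 1 by auto
  moreover have "c' = c\<lparr>buf := (buf c)(i := b), mem := (mem c)(x := d)\<rparr>" using 1 by simp
  ultimately show ?thesis using assms(1) unfolding configs_def by simp
qed

lemma updates_configs:
  assumes "(update_step P)\<^sup>*\<^sup>* c c'" "c \<in> configs P"
  shows "c' \<in> configs P"
  using assms by induction (auto intro: update_step_configs)

lemma tso_move_configs:
  assumes "program P" "x \<in> conf_A (tso_game P) \<union> conf_B (tso_game P)" "move (tso_game P) x y"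
  shows "y \<in> conf_A (tso_game P) \<union> conf_B (tso_game P)"
proof -
  have "tso_move P x y" using assms(3) by (simp add: tso_game_def)
  then show ?thesis
    using assms(2)
    by cases (auto simp: tso_game_def intro: instr_step_configs[OF assms(1)] updates_configs)
qed

lemma tso_move_Turn_A:
  "move (tso_game P) (Turn_A c) g \<longleftrightarrow> (\<exists>i c'. g = Turn_B c' \<and> instr_step P i c c')"
  by (auto simp: tso_game_def tso_move.simps)

lemma tso_move_Turn_B:
  "move (tso_game P) (Turn_B c) g \<longleftrightarrow> (\<exists>c'. g = Turn_A c' \<and> (update_step P)\<^sup>*\<^sup>* c c')"
  by (auto simp: tso_game_def tso_move.simps)

lemma no_succ_Turn_A: "no_succ (tso_game P) (Turn_A c) \<longleftrightarrow> (\<nexists>i c'. instr_step P i c c')"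
  unfolding no_succ_def tso_move_Turn_A by blast

lemma no_succ_Turn_B: "\<not> no_succ (tso_game P) (Turn_B c)"
  unfolding no_succ_def tso_move_Turn_B by blast

section \<open>Winning criteria for the two players\<close>

definition immediate_win ::
  "('i, 'q, 'x, 'v) program \<Rightarrow> 'q set \<Rightarrow> ('i, 'q, 'x, 'v) config \<Rightarrow> bool" where
  "immediate_win P F c \<longleftrightarrow> in_target P F c \<or>
     (\<nexists>i c'. instr_step P i c c') \<and> (\<exists>i\<in>procs P. buf c i \<noteq> [])"

text \<open>The attractor of the immediate wins, graded by the moves of the process player; each of
  them is answered by any number of updates.\<close>

fun wins_within ::
  "('i, 'q, 'x, 'v) program \<Rightarrow> 'q set \<Rightarrow> nat \<Rightarrow> ('i, 'q, 'x, 'v) config \<Rightarrow> bool" where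
  "wins_within P F 0 c \<longleftrightarrow> immediate_win P F c"
| "wins_within P F (Suc n) c \<longleftrightarrow> immediate_win P F c \<or>
     (\<exists>i c'. instr_step P i c c' \<and> (\<forall>c''. (update_step P)\<^sup>*\<^sup>* c' c'' \<longrightarrow> wins_within P F n c''))"

lemma strategy_of_choice:
  assumes "\<And>g. g \<in> D \<Longrightarrow> \<not> no_succ G g \<Longrightarrow> move G g (f g)"
  shows "strategy G D (\<lambda>h. f (last h))"
  using assms unfolding strategy_def by blast

text \<open>A memoryless strategy works: choose a move all of whose answers have smaller rank. The
  rank drops in every round until the target is visited or the process player is stuck with a
  pending message, which violates update fairness.\<close>

theorem wins_within_winning:
  assumes P: "program P" and c0: "c0 \<in> configs P" and win: "wins_within P F n c0"
  shows "winning_for_A (tso_game P) (W_RU P F) (Turn_A c0)"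
proof -
  let ?G = "tso_game P"
  \<comment> \<open>By monotonicity at most one \<open>n\<close> satisfies the premise, namely the
    rank minus one. Outside the attractor and after an immediate win, every legal move is
    good.\<close>
  define good where "good c c' \<longleftrightarrow> (\<exists>i. instr_step P i c c') \<and>
    (\<forall>n. wins_within P F (Suc n) c \<and> \<not> wins_within P F n c \<and> \<not> immediate_win P F c \<longrightarrow>
      (\<forall>c''. (update_step P)\<^sup>*\<^sup>* c' c'' \<longrightarrow> wins_within P F n c''))" for c c'
  have mono: "wins_within P F m c \<Longrightarrow> m \<le> k \<Longrightarrow> wins_within P F k c" for m k c
  proof (induction m arbitrary: k c)
    case 0
    then show ?case by (cases k) auto
  next
    case (Suc m)
    then obtain l where "k = Suc l" "m \<le> l" by (cases k) auto
    then show ?case using Suc by (auto 4 4)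
  qed
  have ex_good: "\<exists>c'. good c c'" if step: "\<exists>i c'. instr_step P i c c'" for c
  proof (cases "(\<exists>n. wins_within P F (Suc n) c \<and> \<not> wins_within P F n c) \<and> \<not> immediate_win P F c")
    case True
    then obtain n where n: "wins_within P F (Suc n) c" "\<not> wins_within P F n c" by blast
    then obtain i c' where c': "instr_step P i c c'"
        "\<forall>c''. (update_step P)\<^sup>*\<^sup>* c' c'' \<longrightarrow> wins_within P F n c''"
      using True by auto
    have "m = n" if "wins_within P F (Suc m) c" "\<not> wins_within P F m c" for m
      using that n mono by (metis not_less_eq_eq nle_le)
    then show ?thesis using c' unfolding good_def by blast
  next
    case False
    then show ?thesis using step unfolding good_def by blast
  qed
  define f where "f g = Turn_B (SOME c'. good (conf g) c')" for g
  let ?\<sigma> = "\<lambda>h. f (last h)"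
  have good_f: "\<exists>c'. f (Turn_A c) = Turn_B c' \<and> good c c'" if "\<not> no_succ ?G (Turn_A c)" for c
    using someI_ex[OF ex_good] that unfolding f_def no_succ_Turn_A by auto
  have \<sigma>: "strategy ?G (conf_A ?G) ?\<sigma>"
  proof (rule strategy_of_choice)
    fix g
    assume "g \<in> conf_A ?G" and succ: "\<not> no_succ ?G g"
    then obtain c where g: "g = Turn_A c" by (auto simp: tso_game_def)
    then show "move ?G g (f g)" using good_f succ unfolding good_def tso_move_Turn_A g by blast
  qed
  have "won_by_A ?G (W_RU P F) (outcome ?G ?\<sigma> \<tau> (Turn_A c0))"
    if \<tau>: "strategy ?G (conf_B ?G) \<tau>" for \<tau>
  proof -
    interpret strategies ?G ?\<sigma> \<tau> "Turn_A c0"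
      using \<sigma> \<tau> c0 tso_move_configs[OF P] by unfold_locales (auto simp: tso_game_def)
    have reach: "\<exists>k c. (\<forall>j<k. \<not> no_succ ?G (pos j)) \<and> pos k = Turn_A c \<and> immediate_win P F c"
      if "\<forall>j<k. \<not> no_succ ?G (pos j)" "pos k = Turn_A c" "wins_within P F n c" for n k c
      using that
    proof (induction n arbitrary: k c rule: less_induct)
      case (less n)
      show ?case
      proof (cases "immediate_win P F c")
        case True
        then show ?thesis using less.prems by blast
      next
        case False
        show ?thesis
        proof (cases "\<exists>m<n. wins_within P F m c")
          case True
          then show ?thesis using less by blast
        next
          case no_less: False
          \<comment> \<open>Here \<open>n\<close> is the exact rank of \<open>c\<close>, so the
            promise made by \<open>good\<close> applies to \<open>m\<close>.\<close>
          then obtain m where m: "n = Suc m" using less.prems(3) False by (cases n) auto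
          then have "\<not> wins_within P F m c" using no_less by blast
          have succ: "\<not> no_succ ?G (pos k)"
            using less.prems(3) False unfolding m less.prems(2) no_succ_Turn_A by auto
          have conf: "pos k \<in> conf_A ?G"
            using pos_conf[of k] less.prems(1,2) by (auto simp: tso_game_def)
          obtain c' where c': "pos (Suc k) = Turn_B c'" "good c c'"
            using good_f succ conf unfolding last_history_Suc less.prems(2) by auto
          have conf': "pos (Suc k) \<in> conf_A ?G \<union> conf_B ?G"
            using pos_conf[of "Suc k"] less.prems(1) succ by (auto simp: less_Suc_eq)
          have succ': "\<not> no_succ ?G (pos (Suc k))" unfolding c' by (rule no_succ_Turn_B)
          then obtain c'' where c'': "pos (Suc (Suc k)) = Turn_A c''" "(update_step P)\<^sup>*\<^sup>* c' c''"
            using pos_move[OF conf' succ'] unfolding c'(1) tso_move_Turn_B by blast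
          have "wins_within P F m c''"
            using c'(2) c''(2) less.prems(3) \<open>\<not> wins_within P F m c\<close> False unfolding good_def m
            by blast
          moreover have "\<forall>j<Suc (Suc k). \<not> no_succ ?G (pos j)"
            using less.prems(1) succ succ' by (auto simp: less_Suc_eq)
          ultimately show ?thesis using less.IH[of m "Suc (Suc k)" c''] c''(1) m by blast
        qed
      qed
    qed
    obtain k c where k: "\<forall>j<k. \<not> no_succ ?G (pos j)" "pos k = Turn_A c" "immediate_win P F c"
      using reach[of 0 c0 n] win by auto
    let ?o = "outcome ?G ?\<sigma> \<tau> (Turn_A c0)"
    have vis: "Turn_A c \<in> visited ?o" using visited_outcome[of k] k by auto
    have conf: "Turn_A c \<in> conf_A ?G" using pos_conf[of k] k by (auto simp: tso_game_def)
    have "?o \<in> W_RU P F"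
    proof (cases "in_target P F c")
      case True
      then have "Turn_A c \<in> target_confs P F" using conf unfolding target_confs_def by auto
      then show ?thesis using vis outcome_plays unfolding W_RU_def W_R_def by blast
    next
      case False
      then have "no_succ ?G (Turn_A c)" "\<exists>i\<in>procs P. buf c i \<noteq> []"
        using k(3) unfolding immediate_win_def no_succ_Turn_A by auto
      then have "?o \<notin> W_U P" using vis conf unfolding W_U_def by force
      then show ?thesis using outcome_plays unfolding W_RU_def by blast
    qed
    then show ?thesis by (cases ?o) auto
  qed
  then show ?thesis using \<sigma> unfolding winning_for_A_def by blast
qed

text \<open>The set \<open>S\<close> is a trap to which the update player can always return. Zero
  updates are a legal answer, so a finite play ends on a turn of the process player; inside the trap
  its buffers are then empty, and the play is fair.\<close>

theorem update_player_wins: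
  assumes P: "program P" and c0: "c0 \<in> S" and conf: "S \<subseteq> configs P"
    and no_target: "\<And>c. c \<in> S \<Longrightarrow> \<not> in_target P F c"
    and stuck: "\<And>c i. c \<in> S \<Longrightarrow> (\<nexists>i c'. instr_step P i c c') \<Longrightarrow> i \<in> procs P \<Longrightarrow> buf c i = []"
    and step: "\<And>c i c'. c \<in> S \<Longrightarrow> instr_step P i c c' \<Longrightarrow>
      \<not> in_target P F c' \<and> (\<exists>c''\<in>S. (update_step P)\<^sup>*\<^sup>* c' c'')"
  shows "\<not> winning_for_A (tso_game P) (W_RU P F) (Turn_A c0)"
proof
  let ?G = "tso_game P"
  assume "winning_for_A ?G (W_RU P F) (Turn_A c0)"
  then obtain \<sigma> where \<sigma>: "strategy ?G (conf_A ?G) \<sigma>"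
    and won: "\<And>\<tau>. strategy ?G (conf_B ?G) \<tau> \<Longrightarrow> won_by_A ?G (W_RU P F) (outcome ?G \<sigma> \<tau> (Turn_A c0))"
    unfolding winning_for_A_def by blast
  \<comment> \<open>The second conjunct is conditional so that every configuration has a witness, at
    worst zero updates; a strategy has to be legal outside the trap as well.\<close>
  define good where "good c c' \<longleftrightarrow> (update_step P)\<^sup>*\<^sup>* c c' \<and>
    ((\<exists>c''\<in>S. (update_step P)\<^sup>*\<^sup>* c c'') \<longrightarrow> c' \<in> S)" for c c'
  have ex_good: "\<exists>c'. good c c'" for c
    unfolding good_def by blast
  define f where "f g = Turn_A (SOME c'. good (conf g) c')" for g
  let ?\<tau> = "\<lambda>h. f (last h)"
  have good_f: "\<exists>c'. f (Turn_B c) = Turn_A c' \<and> good c c'" for c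
    using someI_ex[OF ex_good] unfolding f_def by auto
  have \<tau>: "strategy ?G (conf_B ?G) ?\<tau>"
  proof (rule strategy_of_choice)
    fix g
    assume "g \<in> conf_B ?G"
    then obtain c where g: "g = Turn_B c" by (auto simp: tso_game_def)
    then show "move ?G g (f g)" using good_f unfolding good_def tso_move_Turn_B g by blast
  qed
  interpret strategies ?G \<sigma> ?\<tau> "Turn_A c0"
    using \<sigma> \<tau> c0 conf tso_move_configs[OF P] by unfold_locales (auto simp: tso_game_def)
  let ?o = "outcome ?G \<sigma> ?\<tau> (Turn_A c0)"
  have inv: "(\<exists>c\<in>S. pos k = Turn_A c) \<or>
      (\<exists>c\<in>S. \<exists>i c'. instr_step P i c c' \<and> pos k = Turn_B c')"
    if "\<forall>j<k. \<not> no_succ ?G (pos j)" for k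
    using that
  proof (induction k)
    case 0
    then show ?case using c0 by simp
  next
    case (Suc k)
    then have succ: "\<not> no_succ ?G (pos k)" by blast
    have "pos k \<in> conf_A ?G \<union> conf_B ?G" using pos_conf[of k] Suc.prems by auto
    then have mv: "move ?G (pos k) (pos (Suc k))" using pos_move succ by blast
    have "(\<exists>c\<in>S. pos k = Turn_A c) \<or>
        (\<exists>c\<in>S. \<exists>i c'. instr_step P i c c' \<and> pos k = Turn_B c')"
      using Suc by auto
    then consider (A) c where "c \<in> S" "pos k = Turn_A c"
      | (B) c i c' where "c \<in> S" "instr_step P i c c'" "pos k = Turn_B c'"
      by blast
    then show ?case
    proof cases
      case A
      then show ?thesis using mv unfolding A(2) tso_move_Turn_A by blast
    next
      case c: B
      have "Turn_B c' \<notin> conf_A ?G" by (auto simp: tso_game_def)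
      then obtain c'' where "pos (Suc k) = Turn_A c''" "good c' c''"
        using good_f[of c'] unfolding last_history_Suc c(3) by auto
      then show ?thesis using step[OF c(1,2)] unfolding good_def by blast
    qed
  qed
  have vis: "g \<in> visited ?o \<Longrightarrow> (\<exists>c\<in>S. g = Turn_A c) \<or>
      (\<exists>c\<in>S. \<exists>i c'. instr_step P i c c' \<and> g = Turn_B c')" for g
  proof (cases rule: outcome_cases)
    case (finite n)
    assume "g \<in> visited ?o"
    then obtain k where "k \<le> n" "g = pos k" unfolding finite(3)
      by (auto simp: less_Suc_eq_le simp del: upt_Suc history.simps)
    then show ?thesis using inv[of k] finite(2) by auto
  next
    case infinite
    assume "g \<in> visited ?o"
    then obtain k where "g = pos k" unfolding infinite(2) by auto
    then show ?thesis using inv[of k] infinite(1) by auto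
  qed
  have "visited ?o \<inter> target_confs P F = {}"
  proof -
    have "\<not> in_target P F (conf g)" if "g \<in> visited ?o" for g
      using vis[OF that] no_target step by auto
    then show ?thesis unfolding target_confs_def by auto
  qed
  then have "?o \<notin> W_R P F" unfolding W_R_def by blast
  moreover have "?o \<in> W_U P"
  proof -
    have "buf (conf g) i = []" if "g \<in> visited ?o" "no_succ ?G g" "i \<in> procs P" for g i
      using vis[OF that(1)] that(2,3) stuck no_succ_Turn_B by (auto simp: no_succ_Turn_A)
    then show ?thesis using outcome_plays unfolding W_U_def by blast
  qed
  ultimately have notin: "?o \<notin> W_RU P F" unfolding W_RU_def by blast
  have "\<not> won_by_A ?G (W_RU P F) ?o"
  proof (cases rule: outcome_cases)
    case (finite n)
    have "pos n \<in> visited ?o" unfolding finite(3) by simp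
    then have "\<exists>c. pos n = Turn_A c" using vis finite(1) no_succ_Turn_B by metis
    then have "pos n \<notin> conf_B ?G" by (auto simp: tso_game_def)
    then show ?thesis using notin unfolding finite(3) by simp
  next
    case infinite
    then show ?thesis using notin by simp
  qed
  then show False using won[OF \<tau>] by blast
qed

section \<open>The relay protocol\<close>

datatype relay_state = Target | Chk nat | Wait nat | Got nat nat | Hold nat nat | Fence nat

text \<open>Code 0 is reserved for \<open>Target\<close>, so that the number 0 can be the target
  state of both processes.\<close>

fun relay_code :: "relay_state \<Rightarrow> nat" where
  "relay_code Target = 0"
| "relay_code (Chk p) = Suc (prod_encode (0, prod_encode (p, 0)))"
| "relay_code (Wait p) = Suc (prod_encode (1, prod_encode (p, 0)))"
| "relay_code (Got p d) = Suc (prod_encode (2, prod_encode (p, d)))"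
| "relay_code (Hold p d) = Suc (prod_encode (3, prod_encode (p, d)))"
| "relay_code (Fence p) = Suc (prod_encode (4, prod_encode (p, 0)))"

lemma relay_code_eq [simp]: "relay_code a = relay_code b \<longleftrightarrow> a = b"
  by (cases a; cases b) (auto simp: prod_encode_eq)

lemma relay_code_0 [simp]: "relay_code a = 0 \<longleftrightarrow> a = Target" "0 = relay_code a \<longleftrightarrow> a = Target"
  by (cases a; simp)+

declare relay_code.simps(2-) [simp del]

text \<open>The parity \<open>p\<close> is the variable, \<open>0\<close> or \<open>1\<close>, of the next message. \<open>Hold\<close> forwards the value only
  after the reset: while the buffer of the relay is nonempty, the writer still sees the previous
  value and cannot move, so the update player has to empty that buffer.\<close>

inductive relay_step :: "nat \<Rightarrow> relay_state \<Rightarrow> (nat, nat) instr \<Rightarrow> relay_state \<Rightarrow> bool" for K where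
  alarm: "\<lbrakk>p < 2; v < 2; 0 < d; d < K\<rbrakk> \<Longrightarrow> relay_step K (Chk p) (Rd v d) Target"
| wait: "p < 2 \<Longrightarrow> relay_step K (Chk p) Skip (Wait p)"
| receive: "\<lbrakk>p < 2; 0 < d; d < K\<rbrakk> \<Longrightarrow> relay_step K (Wait p) (Rd p d) (Got p d)"
| alarm': "\<lbrakk>p < 2; 0 < d; d < K\<rbrakk> \<Longrightarrow> relay_step K (Wait p) (Rd (1 - p) d) Target"
| reset: "\<lbrakk>p < 2; 0 < d; d < K\<rbrakk> \<Longrightarrow> relay_step K (Got p d) (Wr p 0) (Hold p d)"
| forward: "\<lbrakk>p < 2; 0 < d; d < K\<rbrakk> \<Longrightarrow> relay_step K (Hold p d) (Wr 2 d) (Fence p)"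
| fence: "p < 2 \<Longrightarrow> relay_step K (Fence p) Mf (Chk (1 - p))"
| target: "relay_step K Target Skip Target"

definition relay_trans :: "nat \<Rightarrow> (nat \<times> (nat, nat) instr \<times> nat) set" where
  "relay_trans K = {(relay_code a, ins, relay_code b) | a ins b. relay_step K a ins b}"

definition relay_states :: "nat \<Rightarrow> nat set" where
  "relay_states K = relay_code ` ({Target} \<union> Chk ` {..<2} \<union> Wait ` {..<2} \<union> Fence ` {..<2} \<union>
     case_prod Got ` ({..<2} \<times> {..<K}) \<union> case_prod Hold ` ({..<2} \<times> {..<K}))"

lemma finite_relay_states: "finite (relay_states K)"
  unfolding relay_states_def by simp

lemma relay_states_mem:
  "relay_code a \<in> relay_states K \<longleftrightarrow> a \<in> {Target} \<union> Chk ` {..<2} \<union> Wait ` {..<2} \<union> Fence ` {..<2} \<union>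
     case_prod Got ` ({..<2} \<times> {..<K}) \<union> case_prod Hold ` ({..<2} \<times> {..<K})"
  unfolding relay_states_def by (intro inj_image_mem_iff injI) simp

lemma zero_relay_states [simp]: "0 \<in> relay_states K"
  using relay_states_mem[of Target K] by simp

lemma relay_trans_subset:
  assumes "K \<le> n" "0 < n"
  shows "relay_trans K \<subseteq> relay_states K \<times> instrs {..<3} {..<n} \<times> relay_states K"
proof -
  have "relay_code a \<in> relay_states K \<and> ins \<in> instrs {..<3} {..<n} \<and> relay_code b \<in> relay_states K"
    if "relay_step K a ins b" for a ins b
    using that assms
    by cases (auto simp: relay_states_mem instrs_def image_iff)
  then show ?thesis unfolding relay_trans_def by blast
qed

lemma relay_transI: "relay_step K a ins b \<Longrightarrow> (relay_code a, ins, relay_code b) \<in> relay_trans K"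
  unfolding relay_trans_def by blast

lemma relay_trans_source:
  "(relay_code a, ins, q) \<in> relay_trans K \<longleftrightarrow> (\<exists>b. q = relay_code b \<and> relay_step K a ins b)"
  unfolding relay_trans_def by auto

fun alternating :: "nat \<Rightarrow> nat \<Rightarrow> (nat \<times> nat) list \<Rightarrow> bool" where
  "alternating K p [] \<longleftrightarrow> True"
| "alternating K p ((v, d) # u) \<longleftrightarrow> v = p \<and> 0 < d \<and> d < K \<and> alternating K (1 - p) u"

lemma alternating_items:
  "alternating K p u \<Longrightarrow> p < 2 \<Longrightarrow> (v, d) \<in> set u \<Longrightarrow> v < 2 \<and> 0 < d \<and> d < K"
  by (induction K p u rule: alternating.induct) auto

definition blocked :: "(nat \<times> (nat, nat) instr \<times> nat) set \<Rightarrow> nat \<Rightarrow> nat \<Rightarrow> bool" where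
  "blocked \<delta> q z \<longleftrightarrow> (\<forall>ins q'. (q, ins, q') \<in> \<delta> \<longrightarrow> (\<exists>e. ins = Rd 2 e \<and> e \<noteq> z))"

text \<open>Faithful runs: the relay delivers a message exactly when the writer is blocked. Here \<open>u\<close> lists the
  pending messages, oldest first, \<open>z\<close> is the last forwarded value and \<open>p\<close> the parity.\<close>

inductive reaches_target ::
  "nat \<Rightarrow> (nat \<times> (nat, nat) instr \<times> nat) set \<Rightarrow> nat \<Rightarrow> (nat \<times> nat) list \<Rightarrow> nat \<Rightarrow> nat \<Rightarrow> bool"
  for K \<delta> where
  target: "reaches_target K \<delta> 0 u z p"
| send: "\<lbrakk>(q, Wr v d, q') \<in> \<delta>; alternating K p (u @ [(v, d)]);
    reaches_target K \<delta> q' (u @ [(v, d)]) z p\<rbrakk> \<Longrightarrow> reaches_target K \<delta> q u z p"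
| get: "\<lbrakk>(q, Rd 2 z, q') \<in> \<delta>; reaches_target K \<delta> q' u z p\<rbrakk> \<Longrightarrow> reaches_target K \<delta> q u z p"
| deliver: "\<lbrakk>blocked \<delta> q z; reaches_target K \<delta> q u d (1 - p)\<rbrakk>
    \<Longrightarrow> reaches_target K \<delta> q ((p, d) # u) z p"

lemma less_2_iff: "p < (2::nat) \<longleftrightarrow> p = 0 \<or> p = 1"
  by auto

section \<open>Faithful runs as wins of the process player\<close>

locale relay_program =
  fixes K :: nat and \<delta> :: "(nat \<times> (nat, nat) instr \<times> nat) set"
    and P :: "(nat, nat, nat, nat) program"
  assumes program: "program P" and K: "0 < K"
    and procs: "procs P = {..<2}"
    and trans_0: "trans_rel P 0 = \<delta>" and trans_1: "trans_rel P 1 = relay_trans K"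
    and \<delta>_cases: "\<And>q ins q'. (q, ins, q') \<in> \<delta> \<Longrightarrow>
      (\<exists>v d. ins = Wr v d \<and> v < 2 \<and> 0 < d \<and> d < K) \<or> (\<exists>d. ins = Rd 2 d) \<or>
      ins = Skip \<and> q = 0 \<and> q' = 0"
begin

lemma proc_cases: "i \<in> procs P \<longleftrightarrow> i = 0 \<or> i = 1"
  unfolding procs by auto

lemma update_step_iff:
  "update_step P c c' \<longleftrightarrow> (\<exists>i b x d. (i = 0 \<or> i = 1) \<and> buf c i = b @ [(x, d)] \<and>
     c' = c\<lparr>buf := (buf c)(i := b), mem := (mem c)(x := d)\<rparr>)"
  unfolding update_step.simps proc_cases by blast

lemma update_stepE:
  assumes "update_step P c c'"
  obtains (writer) b x d where "buf c 0 = b @ [(x, d)]"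
      "c' = c\<lparr>buf := (buf c)(0 := b), mem := (mem c)(x := d)\<rparr>"
  | (relay) b x d where "buf c 1 = b @ [(x, d)]"
      "c' = c\<lparr>buf := (buf c)(1 := b), mem := (mem c)(x := d)\<rparr>"
  using assms unfolding update_step_iff by blast

lemma updates_invariant:
  assumes "\<And>c c'. J c \<Longrightarrow> update_step P c c' \<Longrightarrow> J c'" "(update_step P)\<^sup>*\<^sup>* c c'" "J c"
  shows "J c'"
  using assms(2,3) by induction (auto intro: assms(1))

lemma relay_stepI:
  assumes "st c 1 = relay_code a" "relay_step K a ins b"
    "case ins of Rd x d \<Rightarrow> read_value c 1 x = d | Mf \<Rightarrow> buf c 1 = [] | _ \<Rightarrow> True"
  shows "instr_step P 1 c (case ins of
      Wr x d \<Rightarrow> c\<lparr>st := (st c)(1 := relay_code b), buf := (buf c)(1 := (x, d) # buf c 1)\<rparr>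
    | _ \<Rightarrow> c\<lparr>st := (st c)(1 := relay_code b)\<rparr>)"
proof -
  have "(st c 1, ins, relay_code b) \<in> trans_rel P 1" "1 \<in> procs P"
    using assms relay_transI unfolding trans_1 proc_cases by auto
  then show ?thesis using assms(3) by (cases ins) (auto intro: instr_step.intros)
qed

lemma relay_step_enabled:
  assumes "instr_step P 1 c c'" "st c 1 = relay_code a"
  obtains ins b where "relay_step K a ins b"
    "case ins of Rd x d \<Rightarrow> read_value c 1 x = d | Mf \<Rightarrow> buf c 1 = [] | _ \<Rightarrow> True"
    "c' = (case ins of
      Wr x d \<Rightarrow> c\<lparr>st := (st c)(1 := relay_code b), buf := (buf c)(1 := (x, d) # buf c 1)\<rparr>
    | _ \<Rightarrow> c\<lparr>st := (st c)(1 := relay_code b)\<rparr>)"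
  using assms(1)
proof cases
  case (rd x d q)
  then obtain b where "q = relay_code b" "relay_step K a (Rd x d) b"
    using assms(2) unfolding trans_1 by (auto simp: relay_trans_source)
  then show ?thesis using that[of "Rd x d" b] rd by simp
next
  case (wr x d q)
  then obtain b where "q = relay_code b" "relay_step K a (Wr x d) b"
    using assms(2) unfolding trans_1 by (auto simp: relay_trans_source)
  then show ?thesis using that[of "Wr x d" b] wr by simp
next
  case (skip q)
  then obtain b where "q = relay_code b" "relay_step K a Skip b"
    using assms(2) unfolding trans_1 by (auto simp: relay_trans_source)
  then show ?thesis using that[of Skip b] skip by simp
next
  case (mf q)
  then obtain b where "q = relay_code b" "relay_step K a Mf b"
    using assms(2) unfolding trans_1 by (auto simp: relay_trans_source)
  then show ?thesis using that[of Mf b] mf by simp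
qed

lemma instr_step_proc: "instr_step P i c c' \<Longrightarrow> i = 0 \<or> i = 1"
  by (auto elim!: instr_step.cases simp: procs)

lemma read_value_empty [simp]: "buf c i = [] \<Longrightarrow> read_value c i x = mem c x"
  by (simp add: read_value_def)

text \<open>Both processes can observe the memory under these bounds: the writer has no pending
  message on variable 2, so its reads go to memory, and every nonzero value in variables 0 and 1 is
  in the range of the alarm transitions.\<close>

definition sound :: "(nat, nat, nat, nat) config \<Rightarrow> bool" where
  "sound c \<longleftrightarrow> (\<forall>(v, d)\<in>set (buf c 0). v < 2 \<and> 0 < d \<and> d < K) \<and>
     (\<forall>(v, d)\<in>set (buf c 1). d < K) \<and> mem c 0 < K \<and> mem c 1 < K"

lemma read_value_2: "sound c \<Longrightarrow> read_value c 0 2 = mem c 2"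
proof -
  assume "sound c"
  then have "2 \<notin> fst ` set (buf c 0)" unfolding sound_def by force
  then have "map_of (buf c 0) 2 = None" by (simp add: map_of_eq_None_iff)
  then show ?thesis by (simp add: read_value_def)
qed

lemma sound_update: "sound c \<Longrightarrow> update_step P c c' \<Longrightarrow> sound c'"
  by (erule update_stepE) (auto simp: sound_def)

lemma blocked_no_step:
  assumes "blocked \<delta> (st c 0) (mem c 2)" "sound c"
  shows "\<not> instr_step P 0 c c'"
proof
  assume "instr_step P 0 c c'"
  then show False
    using assms read_value_2 unfolding blocked_def
    by cases (auto simp: trans_0)
qed

lemma not_blocked_step:
  assumes "\<not> blocked \<delta> (st c 0) (mem c 2)" "sound c"
  shows "\<exists>c'. instr_step P 0 c c'"
proof -
  obtain ins q' where ins: "(st c 0, ins, q') \<in> trans_rel P 0" "\<And>e. ins = Rd 2 e \<Longrightarrow> e = mem c 2"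
    using assms(1) unfolding blocked_def trans_0 by blast
  have i: "0 \<in> procs P" by (simp add: procs)
  consider (send) v d where "ins = Wr v d" | (get) d where "ins = Rd 2 d" | (halt) "ins = Skip"
    using \<delta>_cases ins(1) unfolding trans_0 by blast
  then show ?thesis
  proof cases
    case send
    then show ?thesis using instr_step.wr[OF i] ins(1) by blast
  next
    case get
    then show ?thesis using instr_step.rd[OF i] ins read_value_2[OF assms(2)] by blast
  next
    case halt
    then show ?thesis using instr_step.skip[OF i] ins(1) by blast
  qed
qed

abbreviation "wins \<equiv> wins_within P {0}"

abbreviation "updates \<equiv> (update_step P)\<^sup>*\<^sup>*"

lemma wins_target: "st c 0 = 0 \<or> st c 1 = 0 \<Longrightarrow> wins n c"
proof -
  assume "st c 0 = 0 \<or> st c 1 = 0"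
  then have "\<exists>i\<in>procs P. st c i = 0" by (auto simp: procs)
  then have "immediate_win P {0} c"
    unfolding immediate_win_def in_target_def by simp
  then show ?thesis by (cases n) auto
qed

lemma wins_stuck:
  assumes "\<And>c'. \<not> instr_step P 0 c c'" "\<And>c'. \<not> instr_step P 1 c c'" "buf c 0 \<noteq> [] \<or> buf c 1 \<noteq> []"
  shows "wins n c"
proof -
  have "immediate_win P {0} c"
  proof -
    have "\<exists>i\<in>procs P. buf c i \<noteq> []" using assms(3) by (auto simp: procs)
    moreover have "\<nexists>i c'. instr_step P i c c'" using assms(1,2) instr_step_proc by blast
    ultimately show ?thesis unfolding immediate_win_def by blast
  qed
  then show ?thesis by (cases n) auto
qed

text \<open>The answer may consist of any number of updates, so the predicate \<open>J\<close> has
  to survive each single one.\<close>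

lemma wins_step:
  assumes "instr_step P i c c'" "J c'" "\<And>c c'. J c \<Longrightarrow> update_step P c c' \<Longrightarrow> J c'"
    "\<And>c. J c \<Longrightarrow> wins n c"
  shows "wins (Suc n) c"
proof -
  have "wins n c''" if "updates c' c''" for c''
    using assms(4)[OF updates_invariant[of J, OF assms(3) that assms(2)]] .
  then show ?thesis unfolding wins_within.simps using assms(1) by blast
qed

lemma wins_alarm:
  assumes "st c 1 = relay_code a" "relay_step K a (Rd v d) Target" "buf c 1 = []" "mem c v = d"
  shows "wins (Suc n) c"
proof -
  let ?J = "\<lambda>c. st c 1 = 0"
  have "instr_step P 1 c (c\<lparr>st := (st c)(1 := 0)\<rparr>)"
    using relay_stepI[OF assms(1,2)] assms(3,4) by simp
  then show ?thesis
    by (rule wins_step[where J = ?J]) (auto elim: update_stepE intro: wins_target)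
qed

text \<open>The alternatives with a nonzero variable are configurations after a premature update. They are
  stable under further updates, because every pending message of the writer has a nonzero value.\<close>

definition at_chk where
  "at_chk q u z p c \<longleftrightarrow> sound c \<and> st c 0 = q \<and> st c 1 = relay_code (Chk p) \<and> buf c 1 = [] \<and>
     mem c 2 = z \<and> (buf c 0 = rev u \<and> mem c 0 = 0 \<and> mem c 1 = 0 \<or> mem c 0 \<noteq> 0 \<or> mem c 1 \<noteq> 0)"

text \<open>One delivery is legal here: a nonzero value in variable \<open>p\<close> may be the
  awaited message, and only a nonzero value in variable \<open>1 - p\<close> is evidence of a second
  one.\<close>

definition at_wait where
  "at_wait q d u z p c \<longleftrightarrow> sound c \<and> st c 0 = q \<and> st c 1 = relay_code (Wait p) \<and> buf c 1 = [] \<and>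
     mem c 2 = z \<and> (buf c 0 = rev u @ [(p, d)] \<and> mem c p = 0 \<and> mem c (1 - p) = 0 \<or>
       buf c 0 = rev u \<and> mem c p = d \<and> mem c (1 - p) = 0 \<or> mem c (1 - p) \<noteq> 0)"

definition at_got where
  "at_got q d u z p c \<longleftrightarrow> sound c \<and> st c 0 = q \<and> st c 1 = relay_code (Got p d) \<and> buf c 1 = [] \<and>
     mem c 2 = z \<and> (buf c 0 = rev u \<or> mem c (1 - p) \<noteq> 0)"

text \<open>Once the reset is in memory, variable \<open>p\<close> is zero unless a later message
  was delivered to it. Such a message is preceded by one on \<open>1 - p\<close>, whose trace the
  implication records.\<close>

definition at_hold where
  "at_hold q d u z p c \<longleftrightarrow> sound c \<and> st c 0 = q \<and> st c 1 = relay_code (Hold p d) \<and> mem c 2 = z \<and>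
     (buf c 1 = [(p, 0)] \<or> buf c 1 = [] \<and> (mem c (1 - p) = 0 \<longrightarrow> mem c p = 0)) \<and>
     (buf c 0 = rev u \<or> mem c (1 - p) \<noteq> 0)"

text \<open>The three disjuncts follow the messages of the relay: none, the reset alone, or both are
  in memory. Variable 2 changes only with the last one.\<close>

definition at_fence where
  "at_fence q d u z p c \<longleftrightarrow> sound c \<and> st c 0 = q \<and> st c 1 = relay_code (Fence p) \<and>
     (buf c 1 = [(2, d), (p, 0)] \<and> mem c 2 = z \<or>
      buf c 1 = [(2, d)] \<and> mem c 2 = z \<and> (mem c (1 - p) = 0 \<longrightarrow> mem c p = 0) \<or>
      buf c 1 = [] \<and> mem c 2 = d \<and> (mem c (1 - p) = 0 \<longrightarrow> mem c p = 0)) \<and>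
     (buf c 0 = rev u \<or> mem c (1 - p) \<noteq> 0)"

lemma alternating_rev_snoc:
  "alternating K p u \<Longrightarrow> rev u = b @ [(v, d)] \<Longrightarrow> v = p \<and> 0 < d \<and> d < K"
  by (cases u) (auto split: prod.splits)

lemma writer_item:
  assumes "sound c" "buf c 0 = b @ [(x, e)]"
  shows "x < 2" "0 < e" "e < K"
  using assms unfolding sound_def by auto

lemma at_chk_update:
  assumes u: "alternating K p u" and p: "p < 2" and c: "at_chk q u z p c" and upd: "update_step P c c'"
  shows "at_chk q u z p c'"
  using upd
proof (cases rule: update_stepE)
  case (writer b x e)
  have "x = 0 \<or> x = 1" "0 < e" using writer_item[OF _ writer(1)] c unfolding at_chk_def by auto
  then have "mem c' 0 \<noteq> 0 \<or> mem c' 1 \<noteq> 0" "mem c' 2 = mem c 2" using writer(2) by auto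
  then show ?thesis using sound_update[OF _ upd] c unfolding at_chk_def writer(2) by simp
next
  case relay
  then show ?thesis using c unfolding at_chk_def by simp
qed

text \<open>By alternation the first message delivered too early is on variable
  \<open>1 - p\<close>. Later ones are nonzero too and cannot erase the trace.\<close>

lemma writer_spill:
  assumes "alternating K (1 - p) u" "p < 2" "sound c" "buf c 0 = rev u \<or> mem c (1 - p) \<noteq> 0"
    "buf c 0 = b @ [(x, e)]" "c' = c\<lparr>buf := (buf c)(0 := b), mem := (mem c)(x := e)\<rparr>"
  shows "mem c' (1 - p) \<noteq> 0" "mem c' 2 = mem c 2" "st c' = st c" "buf c' 1 = buf c 1"
proof -
  have e: "x < 2" "0 < e" using writer_item assms(3,5) by blast+
  show "mem c' (1 - p) \<noteq> 0"
  proof (cases "buf c 0 = rev u")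
    case True
    then have "x = 1 - p" using alternating_rev_snoc assms(1,5) by metis
    then show ?thesis using e assms(6) by simp
  next
    case False
    then show ?thesis using e assms(4,6) by simp
  qed
  show "mem c' 2 = mem c 2" "st c' = st c" "buf c' 1 = buf c 1" using e assms(6) by auto
qed

lemma at_wait_update:
  assumes u: "alternating K (1 - p) u" and p: "p < 2" and d: "0 < d"
    and c: "at_wait q d u z p c" and upd: "update_step P c c'"
  shows "at_wait q d u z p c'"
  using upd
proof (cases rule: update_stepE)
  case (writer b x e)
  show ?thesis
  proof (cases "buf c 0 = rev u \<or> mem c (1 - p) \<noteq> 0")
    case True
    have "sound c" using c unfolding at_wait_def by simp
    note s = writer_spill[OF u p this True writer]
    then show ?thesis using sound_update[OF _ upd] c unfolding at_wait_def by auto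
  next
    case False
    \<comment> \<open>The awaited message is still pending and is the oldest one, so this update is
      its legal delivery.\<close>
    then have "buf c 0 = rev u @ [(p, d)]" "mem c p = 0" "mem c (1 - p) = 0"
      using c unfolding at_wait_def by auto
    moreover from this have "b = rev u" "x = p" "e = d" using writer(1) by auto
    moreover have "1 - p \<noteq> p" using p by (cases p; auto)+
    ultimately have "buf c' 0 = rev u" "mem c' p = d" "mem c' (1 - p) = 0" "mem c' 2 = mem c 2"
        "st c' = st c" "buf c' 1 = buf c 1"
      using writer(2) p by auto
    then show ?thesis using sound_update[OF _ upd] c unfolding at_wait_def by auto
  qed
next
  case relay
  then show ?thesis using c unfolding at_wait_def by simp
qed

lemma at_got_update:
  assumes u: "alternating K (1 - p) u" and p: "p < 2"
    and c: "at_got q d u z p c" and upd: "update_step P c c'"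
  shows "at_got q d u z p c'"
  using upd
proof (cases rule: update_stepE)
  case (writer b x e)
  have "sound c" "buf c 0 = rev u \<or> mem c (1 - p) \<noteq> 0" using c unfolding at_got_def by simp_all
  note s = writer_spill[OF u p this writer]
  then show ?thesis using sound_update[OF _ upd] c unfolding at_got_def by auto
next
  case relay
  then show ?thesis using c unfolding at_got_def by simp
qed

lemma at_hold_update:
  assumes u: "alternating K (1 - p) u" and p: "p < 2"
    and c: "at_hold q d u z p c" and upd: "update_step P c c'"
  shows "at_hold q d u z p c'"
  using upd
proof (cases rule: update_stepE)
  case (writer b x e)
  have "sound c" "buf c 0 = rev u \<or> mem c (1 - p) \<noteq> 0" using c unfolding at_hold_def by simp_all
  note s = writer_spill[OF u p this writer]
  then show ?thesis using sound_update[OF _ upd] c unfolding at_hold_def by auto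
next
  case (relay b x e)
  then have "b = []" "x = p" "e = 0" using c unfolding at_hold_def by auto
  moreover have "p \<noteq> 2" "1 - p \<noteq> p" using p by (cases p; auto)+
  ultimately show ?thesis
    using sound_update[OF _ upd] c unfolding at_hold_def relay(2) by simp
qed

lemma at_fence_update:
  assumes u: "alternating K (1 - p) u" and p: "p < 2"
    and c: "at_fence q d u z p c" and upd: "update_step P c c'"
  shows "at_fence q d u z p c'"
  using upd
proof (cases rule: update_stepE)
  case (writer b x e)
  have "sound c" "buf c 0 = rev u \<or> mem c (1 - p) \<noteq> 0" using c unfolding at_fence_def by simp_all
  note s = writer_spill[OF u p this writer]
  then show ?thesis using sound_update[OF _ upd] c unfolding at_fence_def by auto
next
  case (relay b x e)
  then have "b = [(2, d)] \<and> x = p \<and> e = 0 \<and> mem c 2 = z \<or>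
      b = [] \<and> x = 2 \<and> e = d \<and> (mem c (1 - p) = 0 \<longrightarrow> mem c p = 0)"
    using c unfolding at_fence_def by (auto simp: append_eq_Cons_conv Cons_eq_append_conv)
  moreover have "p \<noteq> 2" "1 - p \<noteq> p" "1 - p \<noteq> 2" using p by (cases p; auto)+
  moreover have "sound c'" "buf c 0 = rev u \<or> mem c (1 - p) \<noteq> 0" "st c 0 = q"
      "st c 1 = relay_code (Fence p)"
    using sound_update[OF _ upd] c unfolding at_fence_def by auto
  ultimately show ?thesis
    unfolding at_fence_def relay(2) by (elim disjE conjE) simp_all
qed

text \<open>As long as the buffer of the relay is nonempty, variable 2 still holds \<open>z\<close>.
  The writer is then blocked and the relay held up by the fence, so the process player wins by
  update fairness. With an empty buffer the next round starts with flipped parity.\<close>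

lemma fence_wins:
  assumes u: "alternating K (1 - p) u" and p: "p < 2" and z: "blocked \<delta> q z"
    and win: "\<And>c. at_chk q u d (1 - p) c \<Longrightarrow> wins n c" and c: "at_fence q d u z p c"
  shows "wins (Suc n) c"
proof (cases "buf c 1 = []")
  case True
  have p': "1 - p < 2" by simp
  let ?c = "c\<lparr>st := (st c)(1 := relay_code (Chk (1 - p)))\<rparr>"
  have "st c 1 = relay_code (Fence p)" using c unfolding at_fence_def by blast
  then have "instr_step P 1 c ?c"
    using relay_stepI[of c "Fence p" Mf "Chk (1 - p)"] relay_step.fence[OF p] True by simp
  moreover have "at_chk q u d (1 - p) ?c"
    using p unfolding less_2_iff
    by (elim disjE) (use c True in \<open>auto simp: at_fence_def at_chk_def sound_def\<close>)
  ultimately show ?thesis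
    using at_chk_update[OF u p'] win by (rule wins_step)
next
  case False
  have "blocked \<delta> (st c 0) (mem c 2)" "sound c" using c z False unfolding at_fence_def by auto
  then have "\<not> instr_step P 0 c c'" for c' by (rule blocked_no_step)
  moreover have "\<not> instr_step P 1 c c'" for c'
  proof
    assume "instr_step P 1 c c'"
    moreover have "st c 1 = relay_code (Fence p)" using c unfolding at_fence_def by simp
    ultimately show False
      by (rule relay_step_enabled) (use False in \<open>auto elim: relay_step.cases\<close>)
  qed
  ultimately show ?thesis using wins_stuck False by blast
qed

lemma hold_wins:
  assumes u: "alternating K (1 - p) u" and p: "p < 2" and d: "0 < d" "d < K"
    and win: "\<And>c. at_fence q d u z p c \<Longrightarrow> wins n c" and c: "at_hold q d u z p c"
  shows "wins (Suc n) c"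
proof -
  let ?c = "c\<lparr>st := (st c)(1 := relay_code (Fence p)), buf := (buf c)(1 := (2, d) # buf c 1)\<rparr>"
  have "instr_step P 1 c ?c"
    using relay_stepI[of c "Hold p d" "Wr 2 d" "Fence p"] relay_step.forward[OF p d] c unfolding at_hold_def by simp
  moreover have "at_fence q d u z p ?c"
    using c d unfolding at_hold_def at_fence_def sound_def by auto
  ultimately show ?thesis
    using at_fence_update[OF u p] win by (rule wins_step)
qed

lemma got_wins:
  assumes u: "alternating K (1 - p) u" and p: "p < 2" and d: "0 < d" "d < K"
    and win: "\<And>c. at_hold q d u z p c \<Longrightarrow> wins n c" and c: "at_got q d u z p c"
  shows "wins (Suc n) c"
proof -
  let ?c = "c\<lparr>st := (st c)(1 := relay_code (Hold p d)), buf := (buf c)(1 := (p, 0) # buf c 1)\<rparr>"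
  have "instr_step P 1 c ?c"
    using relay_stepI[of c "Got p d" "Wr p 0" "Hold p d"] relay_step.reset[OF p d] c unfolding at_got_def by simp
  moreover have "at_hold q d u z p ?c"
    using c d unfolding at_got_def at_hold_def sound_def by auto
  ultimately show ?thesis
    using at_hold_update[OF u p] win by (rule wins_step)
qed

text \<open>With a trace of a second delivery the relay raises the alarm, with just the awaited
  message in memory it goes on, and with none delivered the process player is stuck on a pending
  message and wins.\<close>

lemma wait_wins:
  assumes u: "alternating K (1 - p) u" and p: "p < 2" and d: "0 < d" "d < K" and z: "blocked \<delta> q z"
    and win: "\<And>c. at_got q d u z p c \<Longrightarrow> wins n c" and c: "at_wait q d u z p c"
  shows "wins (Suc n) c"
proof -
  have R: "st c 1 = relay_code (Wait p)" "buf c 1 = []" using c unfolding at_wait_def by auto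
  have sound: "sound c" using c unfolding at_wait_def by simp
  consider (dirty) "mem c (1 - p) \<noteq> 0"
    | (one) "buf c 0 = rev u" "mem c p = d"
    | (none) "buf c 0 = rev u @ [(p, d)]" "mem c p = 0" "mem c (1 - p) = 0"
    using c unfolding at_wait_def by metis
  then show ?thesis
  proof cases
    case dirty
    have "mem c (1 - p) < K" using sound p unfolding sound_def less_2_iff by auto
    then show ?thesis using wins_alarm[OF R(1) relay_step.alarm' R(2) refl] p dirty by blast
  next
    case one
    let ?c = "c\<lparr>st := (st c)(1 := relay_code (Got p d))\<rparr>"
    have "instr_step P 1 c ?c"
      using relay_stepI[of c "Wait p" "Rd p d" "Got p d"] relay_step.receive[OF p d] R one by simp
    moreover have "at_got q d u z p ?c"
      using c one unfolding at_wait_def at_got_def sound_def by auto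
    ultimately show ?thesis
      using at_got_update[OF u p] win by (rule wins_step)
  next
    case none
    have "blocked \<delta> (st c 0) (mem c 2)" using c z unfolding at_wait_def by auto
    then have "\<not> instr_step P 0 c c'" for c' using sound by (rule blocked_no_step)
    moreover have "\<not> instr_step P 1 c c'" for c'
    proof
      assume "instr_step P 1 c c'"
      then show False using R(1)
      proof (rule relay_step_enabled)
        fix ins b
        assume step: "relay_step K (Wait p) ins b" and enabled: "case ins of
          Rd x d \<Rightarrow> read_value c 1 x = d | Mf \<Rightarrow> buf c 1 = [] | _ \<Rightarrow> True"
        from step show False
          by cases (use enabled R none in auto)
      qed
    qed
    moreover have "buf c 0 \<noteq> [] \<or> buf c 1 \<noteq> []" using none(1) by simp
    ultimately show ?thesis by (rule wins_stuck)
  qed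
qed

lemma chk_dirty_wins:
  assumes "at_chk q u z p c" "p < 2" "mem c 0 \<noteq> 0 \<or> mem c 1 \<noteq> 0"
  shows "wins (Suc n) c"
proof -
  obtain v where v: "v < 2" "mem c v \<noteq> 0" using assms(3) by (auto simp: less_2_iff)
  have "mem c v < K" using assms(1) v(1) unfolding at_chk_def sound_def less_2_iff by auto
  then show ?thesis
    using wins_alarm[of c "Chk p" v "mem c v"] relay_step.alarm[of p v "mem c v" K] assms v
    unfolding at_chk_def by simp
qed

text \<open>The bound is uniform over all configurations in \<open>at_chk\<close>, including those
  after premature updates. This lets the induction along the faithful run absorb every answer of the
  update player.\<close>

theorem reaches_target_wins:
  assumes "reaches_target K \<delta> q u z p" "alternating K p u" "p < 2"
  shows "\<exists>n. \<forall>c. at_chk q u z p c \<longrightarrow> wins n c"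
  using assms
proof induction
  case (target u z p)
  then show ?case using wins_target[of _ 0] unfolding at_chk_def by blast
next
  case (send q v d q' p u z)
  then obtain n where n: "\<And>c. at_chk q' (u @ [(v, d)]) z p c \<Longrightarrow> wins n c" by blast
  have vd: "v < 2" "0 < d" "d < K"
    using alternating_items[OF send.hyps(2) send.prems(2), of v d] by auto
  have "wins (Suc n) c" if c: "at_chk q u z p c" for c
  proof (cases "mem c 0 \<noteq> 0 \<or> mem c 1 \<noteq> 0")
    case True
    then show ?thesis using chk_dirty_wins c send.prems(2) by blast
  next
    case False
    let ?c = "c\<lparr>st := (st c)(0 := q'), buf := (buf c)(0 := (v, d) # buf c 0)\<rparr>"
    have "instr_step P 0 c ?c"
      using c send.hyps(1) unfolding at_chk_def by (intro instr_step.wr) (auto simp: procs trans_0)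
    moreover have "at_chk q' (u @ [(v, d)]) z p ?c"
      using c False vd unfolding at_chk_def sound_def by auto
    ultimately show ?thesis
      using at_chk_update[OF send.hyps(2) send.prems(2)] n by (rule wins_step)
  qed
  then show ?case by blast
next
  case (get q z q' u p)
  then obtain n where n: "\<And>c. at_chk q' u z p c \<Longrightarrow> wins n c" by blast
  have "wins (Suc n) c" if c: "at_chk q u z p c" for c
  proof -
    let ?c = "c\<lparr>st := (st c)(0 := q')\<rparr>"
    have "read_value c 0 2 = z" using c read_value_2 unfolding at_chk_def by auto
    then have "instr_step P 0 c ?c"
      using c get.hyps(1) unfolding at_chk_def by (intro instr_step.rd) (auto simp: procs trans_0)
    moreover have "at_chk q' u z p ?c"
      using c unfolding at_chk_def sound_def by auto
    ultimately show ?thesis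
      using at_chk_update[OF get.prems] n by (rule wins_step)
  qed
  then show ?case by blast
next
  case (deliver q z u d p)
  have d: "0 < d" "d < K" and u: "alternating K (1 - p) u" using deliver.prems by auto
  have "1 - p < 2" by simp
  then obtain n where n: "\<And>c. at_chk q u d (1 - p) c \<Longrightarrow> wins n c" using deliver.IH u by blast
  note p = deliver.prems(2)
  note fence = fence_wins[OF u p deliver.hyps(1) n]
  note hold = hold_wins[OF u p d fence]
  note got = got_wins[OF u p d hold]
  note wait = wait_wins[OF u p d deliver.hyps(1) got]
  \<comment> \<open>One move each to receive, reset, forward and pass the fence; going from
    \<open>Chk\<close> to \<open>Wait\<close> is the fifth.\<close>
  let ?n = "Suc (Suc (Suc (Suc n)))"
  have "wins (Suc ?n) c" if c: "at_chk q ((p, d) # u) z p c" for c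
  proof (cases "mem c 0 \<noteq> 0 \<or> mem c 1 \<noteq> 0")
    case True
    then show ?thesis using chk_dirty_wins c p by blast
  next
    case False
    let ?c = "c\<lparr>st := (st c)(1 := relay_code (Wait p))\<rparr>"
    have "instr_step P 1 c ?c"
      using relay_stepI[of c "Chk p" Skip "Wait p"] relay_step.wait[OF p] c unfolding at_chk_def by simp
    moreover have "at_wait q d u z p ?c"
      using c False p unfolding at_chk_def at_wait_def sound_def less_2_iff by auto
    ultimately show ?thesis
      using at_wait_update[OF u p d(1)] wait by (rule wins_step)
  qed
  then show ?case by blast
qed

end

section \<open>The update player's strategy of delivering only under pressure\<close>

locale safe_writer = relay_program +
  fixes I :: "nat \<Rightarrow> (nat \<times> nat) list \<Rightarrow> nat \<Rightarrow> nat \<Rightarrow> bool"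
  assumes I_basic: "\<And>q u z p. I q u z p \<Longrightarrow> q \<noteq> 0 \<and> p < 2 \<and> alternating K p u"
    and I_send: "\<And>q u z p v d q'. I q u z p \<Longrightarrow> (q, Wr v d, q') \<in> \<delta> \<Longrightarrow> I q' (u @ [(v, d)]) z p"
    and I_get: "\<And>q u z p q'. I q u z p \<Longrightarrow> (q, Rd 2 z, q') \<in> \<delta> \<Longrightarrow> I q' u z p"
    and I_deliver: "\<And>q u z p d. I q ((p, d) # u) z p \<Longrightarrow> blocked \<delta> q z \<Longrightarrow> I q u d (1 - p)"
begin

definition idle where
  "idle q u z p c \<longleftrightarrow> I q u z p \<and> st c 0 = q \<and> mem c 2 = z \<and> buf c 0 = rev u \<and> buf c 1 = [] \<and>
     mem c 0 = 0 \<and> mem c 1 = 0"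

definition busy where
  "busy q d u z p r b c \<longleftrightarrow> I q ((p, d) # u) z p \<and> blocked \<delta> q z \<and> st c 0 = q \<and> mem c 2 = z \<and>
     buf c 0 = rev u \<and> buf c 1 = b \<and> mem c p = d \<and> mem c (1 - p) = 0 \<and> st c 1 = relay_code r"

definition idle_region where
  "idle_region q u z p r c \<longleftrightarrow> idle q u z p c \<and> st c 1 = relay_code r \<and>
     (r = Chk p \<or> r = Fence (1 - p) \<or> r = Wait p \<and> (\<not> blocked \<delta> q z \<or> u = []))"

text \<open>The reset stays pending until the relay stands at its fence, because the update player
  acts only when it has to.\<close>

definition busy_region where
  "busy_region q d u z p r b c \<longleftrightarrow> busy q d u z p r b c \<and>
     (r = Wait p \<and> b = [] \<or> r = Got p d \<and> b = [] \<or> r = Hold p d \<and> b = [(p, 0)])"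

definition region :: "(nat, nat, nat, nat) config set" where
  "region = {c \<in> configs P. (\<exists>q u z p r. idle_region q u z p r c) \<or>
     (\<exists>q d u z p r b. busy_region q d u z p r b c)}"

lemma region_cases:
  assumes "c \<in> region"
  obtains (idle) q u z p r where "idle_region q u z p r c"
  | (busy) q d u z p r b where "busy_region q d u z p r b c"
  using assms unfolding region_def by blast

lemma idle_sound: "idle q u z p c \<Longrightarrow> sound c"
proof -
  assume c: "idle q u z p c"
  then have "p < 2" "alternating K p u" using I_basic unfolding idle_def by blast+
  then have items: "v < 2 \<and> 0 < d \<and> d < K" if "(v, d) \<in> set u" for v d
    using alternating_items that by blast
  then show ?thesis using c K unfolding idle_def sound_def by auto
qed

lemma busy_sound:
  assumes c: "busy q d u z p r b c" and b: "b = [] \<or> b = [(p, 0)]"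
  shows "sound c"
proof -
  have p: "p < 2" and u: "alternating K p ((p, d) # u)" using I_basic c unfolding busy_def by blast+
  have items: "v < 2 \<and> 0 < e \<and> e < K" if "(v, e) \<in> set u" for v e
    by (rule alternating_items[OF u p]) (use that in simp)
  have "mem c v < K" if "v < 2" for v
  proof (cases "v = p")
    case True
    then show ?thesis using u c unfolding busy_def by auto
  next
    case False
    then have "v = 1 - p" using that p by auto
    then show ?thesis using K c unfolding busy_def by auto
  qed
  then show ?thesis using c b K items unfolding busy_def sound_def by auto
qed

text \<open>One message is delivered if the relay waits, the writer is blocked and the queue is
  nonempty, since the process player would win there by being stuck. In all other cases the answer
  is zero updates.\<close>

lemma settle:
  assumes conf: "c \<in> configs P" and c: "idle q u z p c"
    and r: "st c 1 = relay_code r" "r = Chk p \<or> r = Fence (1 - p) \<or> r = Wait p"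
  shows "\<not> in_target P {0} c \<and> (\<exists>c'\<in>region. updates c c')"
proof
  have I: "I q u z p" using c unfolding idle_def by blast
  then have q: "q \<noteq> 0" and p: "p < 2" and u: "alternating K p u" using I_basic by blast+
  have "st c 0 \<noteq> 0" "st c 1 \<noteq> 0" using q r c unfolding idle_def by auto
  then show "\<not> in_target P {0} c" unfolding in_target_def by (auto simp: procs less_2_iff)
  show "\<exists>c'\<in>region. updates c c'"
  proof (cases "r = Wait p \<and> blocked \<delta> q z \<and> u \<noteq> []")
    case True
    then obtain v d u' where "u = (v, d) # u'" by (cases u) auto
    then have u': "u = (p, d) # u'" using u by simp
    let ?c = "c\<lparr>buf := (buf c)(0 := rev u'), mem := (mem c)(p := d)\<rparr>"
    have "buf c 0 = rev u' @ [(p, d)]" using c u' unfolding idle_def by simp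
    then have step: "update_step P c ?c" unfolding update_step_iff by blast
    have mem: "mem c 0 = 0" "mem c 1 = 0" "mem c 2 = z" and st: "st c 0 = q" "buf c 1 = []"
      using c unfolding idle_def by blast+
    have "mem ?c (1 - p) = 0" "mem ?c p = d" "mem ?c 2 = z"
      using mem p unfolding less_2_iff by auto
    then have "busy q d u' z p (Wait p) [] ?c"
      unfolding busy_def using True I u' st r by auto
    then have "busy_region q d u' z p (Wait p) [] ?c" unfolding busy_region_def by blast
    moreover have "?c \<in> configs P" using update_step_configs[OF conf step] .
    ultimately have "?c \<in> region" unfolding region_def by blast
    then show ?thesis using step by blast
  next
    case False
    then have "idle_region q u z p r c" using c r unfolding idle_region_def by blast
    then have "c \<in> region" using conf unfolding region_def by blast
    then show ?thesis by blast
  qed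
qed

lemma busy_step:
  assumes c: "busy q d u z p r b c" and sound: "sound c" and step: "instr_step P i c c'"
  obtains ins a where "i = 1" "relay_step K r ins a"
    "case ins of Rd x d \<Rightarrow> read_value c 1 x = d | Mf \<Rightarrow> buf c 1 = [] | _ \<Rightarrow> True"
    "c' = (case ins of
      Wr x d \<Rightarrow> c\<lparr>st := (st c)(1 := relay_code a), buf := (buf c)(1 := (x, d) # buf c 1)\<rparr>
    | _ \<Rightarrow> c\<lparr>st := (st c)(1 := relay_code a)\<rparr>)"
proof -
  have "blocked \<delta> (st c 0) (mem c 2)" "st c 1 = relay_code r" using c unfolding busy_def by auto
  then have "i = 1" using blocked_no_step[OF _ sound] step instr_step_proc by blast
  have "instr_step P 1 c c'" using step \<open>i = 1\<close> by blast
  then show ?thesis using \<open>st c 1 = relay_code r\<close>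
    by (rule relay_step_enabled) (rule that[OF \<open>i = 1\<close>])
qed

lemma busy_not_target:
  assumes "busy q d u z p r b c" "r \<noteq> Target"
  shows "\<not> in_target P {0} c"
proof -
  have "q \<noteq> 0" using assms I_basic unfolding busy_def by blast
  then have "st c 0 \<noteq> 0" "st c 1 \<noteq> 0" using assms unfolding busy_def by auto
  then show "\<not> in_target P {0} c" unfolding in_target_def by (auto simp: procs less_2_iff)
qed

lemma region_step:
  assumes c: "c \<in> region" and step: "instr_step P i c c'"
  shows "\<not> in_target P {0} c' \<and> (\<exists>c''\<in>region. updates c' c'')"
proof -
  have "c \<in> configs P" using c unfolding region_def by blast
  then have conf: "c' \<in> configs P" using instr_step_configs[OF program _ step] by blast
  consider
      (idle) q u z p r where "idle q u z p c" "st c 1 = relay_code r" "r = Chk p \<or> r = Fence (1 - p) \<or> r = Wait p"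
    | (wait) q d u z p where "busy q d u z p (Wait p) [] c"
    | (got) q d u z p where "busy q d u z p (Got p d) [] c"
    | (hold) q d u z p where "busy q d u z p (Hold p d) [(p, 0)] c"
    using c
  proof (cases rule: region_cases)
    case (idle q u z p r)
    then show ?thesis using that(1)[of q u z p r] unfolding idle_region_def by blast
  next
    case (busy q d u z p r b)
    then show ?thesis
      using that(2)[of q d u z p] that(3)[of q d u z p] that(4)[of q d u z p]
      unfolding busy_region_def by auto
  qed
  then show ?thesis
  proof cases
    case (idle q u z p r)
    note sound = idle_sound[OF idle(1)]
    have I: "I q u z p" and st: "st c 0 = q" "mem c 2 = z" "buf c 0 = rev u" "buf c 1 = []"
        "mem c 0 = 0" "mem c 1 = 0"
      using idle(1) unfolding idle_def by auto
    then have q: "q \<noteq> 0" and p: "p < 2" using I_basic by blast+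
    have "i = 0 \<or> i = 1" using instr_step_proc step by blast
    then show ?thesis
    proof
      assume i: "i = 0"
      show ?thesis using step[unfolded i]
      proof cases
        case (rd x e q')
        then have "(q, Rd x e, q') \<in> \<delta>" using st trans_0 by simp
        from \<delta>_cases[OF this] have "x = 2" by simp
        then have "e = z" using rd read_value_2[OF sound] st by simp
        then have "I q' u z p" using I_get[OF I] \<open>(q, Rd x e, q') \<in> \<delta>\<close> \<open>x = 2\<close> by blast
        then have "idle q' u z p c'" unfolding idle_def using st rd by simp
        moreover have "st c' 1 = relay_code r" using rd idle by simp
        ultimately show ?thesis using settle[OF conf _ _ idle(3)] by blast
      next
        case (wr x e q')
        then have "(q, Wr x e, q') \<in> \<delta>" using st trans_0 by simp
        then have "I q' (u @ [(x, e)]) z p" by (rule I_send[OF I])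
        then have "idle q' (u @ [(x, e)]) z p c'" unfolding idle_def using st wr by simp
        moreover have "st c' 1 = relay_code r" using wr idle by simp
        ultimately show ?thesis using settle[OF conf _ _ idle(3)] by blast
      next
        case (skip q')
        then have "(q, Skip, q') \<in> \<delta>" using st trans_0 by simp
        from \<delta>_cases[OF this] show ?thesis using q by simp
      next
        case (mf q')
        then have "(q, Mf, q') \<in> \<delta>" using st trans_0 by simp
        from \<delta>_cases[OF this] show ?thesis by simp
      qed
    next
      assume i: "i = 1"
      from step[unfolded i] idle(2) show ?thesis
      proof (rule relay_step_enabled)
        fix ins a
        assume ra: "relay_step K r ins a" and enabled: "case ins of
            Rd x d \<Rightarrow> read_value c 1 x = d | Mf \<Rightarrow> buf c 1 = [] | _ \<Rightarrow> True"
          and c': "c' = (case ins of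
            Wr x d \<Rightarrow> c\<lparr>st := (st c)(1 := relay_code a), buf := (buf c)(1 := (x, d) # buf c 1)\<rparr>
          | _ \<Rightarrow> c\<lparr>st := (st c)(1 := relay_code a)\<rparr>)"
        have mem: "mem c v = 0" if "v < 2" for v using that st unfolding less_2_iff by auto
        \<comment> \<open>Both queue variables are zero, while alarms and receptions read nonzero
          values; so only the skip to \<open>Wait\<close> and the fence are left.\<close>
        have "(ins = Skip \<or> ins = Mf) \<and> (a = Wait p \<or> a = Chk p)"
          using ra
        proof cases
          case alarm
          then show ?thesis using enabled st(4) mem by simp
        next
          case receive
          then show ?thesis using enabled st(4) mem by simp
        next
          case (alarm' p')
          then have "1 - p' < 2" by simp
          then show ?thesis using alarm' enabled st(4) mem by simp
        next
          case fence
          then show ?thesis using idle(3) p by auto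
        qed (use idle(3) in auto)
        then have c': "c' = c\<lparr>st := (st c)(1 := relay_code a)\<rparr>" and a: "a = Wait p \<or> a = Chk p"
          using c' by auto
        have "idle q u z p c'" using I st unfolding idle_def c' by simp
        moreover have "st c' 1 = relay_code a" unfolding c' by simp
        ultimately show ?thesis using settle[OF conf] a by blast
      qed
    qed
  next
    case (wait q d u z p)
    have p: "p < 2" using wait I_basic unfolding busy_def by blast
    have sound: "sound c" using busy_sound wait by blast
    obtain ins a where a: "relay_step K (Wait p) ins a"
      "case ins of Rd x d \<Rightarrow> read_value c 1 x = d | Mf \<Rightarrow> buf c 1 = [] | _ \<Rightarrow> True"
      "c' = (case ins of
        Wr x d \<Rightarrow> c\<lparr>st := (st c)(1 := relay_code a), buf := (buf c)(1 := (x, d) # buf c 1)\<rparr>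
      | _ \<Rightarrow> c\<lparr>st := (st c)(1 := relay_code a)\<rparr>)"
      using busy_step[OF wait sound step] by blast
    have mem: "mem c p = d" "mem c (1 - p) = 0" "buf c 1 = []" using wait unfolding busy_def by blast+
    have "ins = Rd p d \<and> a = Got p d"
      using a(1)
    proof cases
      case receive
      then show ?thesis using mem a(2) by simp
    next
      case alarm'
      then show ?thesis using mem a(2) by simp
    qed
    then have b: "busy q d u z p (Got p d) [] c'" using wait a(3) unfolding busy_def by simp
    then have "busy_region q d u z p (Got p d) [] c'" unfolding busy_region_def by blast
    then have "c' \<in> region" using conf unfolding region_def by blast
    then show ?thesis using busy_not_target[OF b] by blast
  next
    case (got q d u z p)
    have sound: "sound c" using busy_sound got by blast
    obtain ins a where a: "relay_step K (Got p d) ins a"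
      "c' = (case ins of
        Wr x d \<Rightarrow> c\<lparr>st := (st c)(1 := relay_code a), buf := (buf c)(1 := (x, d) # buf c 1)\<rparr>
      | _ \<Rightarrow> c\<lparr>st := (st c)(1 := relay_code a)\<rparr>)"
      using busy_step[OF got sound step] by blast
    have "ins = Wr p 0 \<and> a = Hold p d" using a(1) by cases auto
    then have b: "busy q d u z p (Hold p d) [(p, 0)] c'" using got a(2) unfolding busy_def by simp
    then have "busy_region q d u z p (Hold p d) [(p, 0)] c'" unfolding busy_region_def by blast
    then have "c' \<in> region" using conf unfolding region_def by blast
    then show ?thesis using busy_not_target[OF b] by blast
  next
    case (hold q d u z p)
    have sound: "sound c" using busy_sound hold by blast
    obtain ins a where a: "relay_step K (Hold p d) ins a"
      "c' = (case ins of
        Wr x d \<Rightarrow> c\<lparr>st := (st c)(1 := relay_code a), buf := (buf c)(1 := (x, d) # buf c 1)\<rparr>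
      | _ \<Rightarrow> c\<lparr>st := (st c)(1 := relay_code a)\<rparr>)"
      using busy_step[OF hold sound step] by blast
    have "ins = Wr 2 d \<and> a = Fence p" using a(1) by cases auto
    then have b: "busy q d u z p (Fence p) [(2, d), (p, 0)] c'"
      using hold a(2) unfolding busy_def by simp
    \<comment> \<open>The relay has reached its fence, so both of its messages are delivered now,
      the reset first because it is older.\<close>
    let ?c1 = "c'\<lparr>buf := (buf c')(1 := [(2, d)]), mem := (mem c')(p := 0)\<rparr>"
    let ?c2 = "?c1\<lparr>buf := (buf ?c1)(1 := []), mem := (mem ?c1)(2 := d)\<rparr>"
    have "buf c' 1 = [(2, d)] @ [(p, 0)]" using b unfolding busy_def by simp
    then have "update_step P c' ?c1" unfolding update_step_iff by blast
    moreover have "buf ?c1 1 = [] @ [(2, d)]" by simp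
    then have "update_step P ?c1 ?c2" unfolding update_step_iff by blast
    ultimately have upd: "updates c' ?c2" by (rule converse_rtranclp_into_rtranclp[OF _ r_into_rtranclp])
    have I: "I q ((p, d) # u) z p" "blocked \<delta> q z" using b unfolding busy_def by simp_all
    then have I': "I q u d (1 - p)" by (rule I_deliver)
    have p: "p < 2" using I(1) I_basic by blast
    have "st c' 0 = q" "buf c' 0 = rev u" "mem c' (1 - p) = 0" "st c' 1 = relay_code (Fence p)"
      using b unfolding busy_def by simp_all
    moreover from this have "mem ?c2 0 = 0" "mem ?c2 1 = 0" using p unfolding less_2_iff by auto
    ultimately have "idle q u d (1 - p) ?c2" "st ?c2 1 = relay_code (Fence p)"
      using I' unfolding idle_def by auto
    \<comment> \<open>Seen from the new parity \<open>1 - p\<close>, the state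
      \<open>Fence p\<close> is the fence of the previous message.\<close>
    moreover have "1 - (1 - p) = p" using p by auto
    moreover have "?c2 \<in> configs P" using updates_configs[OF upd conf] .
    ultimately have "idle_region q u d (1 - p) (Fence p) ?c2" "?c2 \<in> configs P"
      unfolding idle_region_def by simp_all
    then have "?c2 \<in> region" unfolding region_def by blast
    then show ?thesis using upd busy_not_target[OF b] by blast
  qed
qed

text \<open>The relay can always move, its buffer being empty at the fence, unless it waits with
  nothing in memory to receive. If the writer is blocked too, \<open>idle_region\<close> leaves only
  the case of an empty queue.\<close>

lemma region_stuck:
  assumes c: "c \<in> region" and stuck: "\<nexists>i c'. instr_step P i c c'"
  shows "buf c 0 = [] \<and> buf c 1 = []"
proof -
  have no: False if "st c 1 = relay_code r" "relay_step K r ins a"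
      "case ins of Rd x d \<Rightarrow> read_value c 1 x = d | Mf \<Rightarrow> buf c 1 = [] | _ \<Rightarrow> True" for r ins a
    using relay_stepI[OF that] stuck by blast
  from c show ?thesis
  proof (cases rule: region_cases)
    case (idle q u z p r)
    then have idle': "idle q u z p c" and r: "st c 1 = relay_code r" unfolding idle_region_def by blast+
    have p: "p < 2" using idle' I_basic unfolding idle_def by blast
    have "buf c 1 = []" using idle' unfolding idle_def by blast
    then have "r \<noteq> Chk p" "r \<noteq> Fence (1 - p)"
      using no[OF r] relay_step.wait[OF p] relay_step.fence[of "1 - p"] by fastforce+
    moreover have "blocked \<delta> q z"
      using not_blocked_step[OF _ idle_sound[OF idle']] stuck idle' unfolding idle_def by blast
    ultimately have "u = []" using idle unfolding idle_region_def by blast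
    then show ?thesis using idle' unfolding idle_def by simp
  next
    case (busy q d u z p r b)
    then have b: "busy q d u z p r b c" and r: "r = Wait p \<and> b = [] \<or> r = Got p d \<or> r = Hold p d"
      unfolding busy_region_def by blast+
    then have "p < 2" "0 < d" "d < K" using I_basic[of q "(p, d) # u" z p] unfolding busy_def by auto
    note * = relay_step.receive[OF this] relay_step.reset[OF this] relay_step.forward[OF this]
    have "st c 1 = relay_code r" "buf c 1 = b" "mem c p = d" using b unfolding busy_def by auto
    then have False using no[OF _ *(1)] no[OF _ *(2)] no[OF _ *(3)] r by auto
    then show ?thesis ..
  qed
qed

theorem region_not_winning:
  assumes c: "c \<in> configs P" "idle q u z p c" "st c 1 = relay_code (Chk p)"
  shows "\<not> winning_for_A (tso_game P) (W_RU P {0}) (Turn_A c)"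
proof (rule update_player_wins[OF program])
  have "idle_region q u z p (Chk p) c" using c unfolding idle_region_def by blast
  then show "c \<in> region" using c(1) unfolding region_def by blast
  show "region \<subseteq> configs P" unfolding region_def by blast
  show "\<not> in_target P {0} c" if "c \<in> region" for c
  proof -
    from that have "st c 0 \<noteq> 0 \<and> st c 1 \<noteq> 0"
    proof (cases rule: region_cases)
      case (idle q u z p r)
      then show ?thesis using I_basic[of q u z p] unfolding idle_region_def idle_def by auto
    next
      case (busy q d u z p r b)
      then show ?thesis using I_basic[of q "(p, d) # u" z p] unfolding busy_region_def busy_def by auto
    qed
    then show ?thesis unfolding in_target_def by (auto simp: procs less_2_iff)
  qed
  show "buf c i = []" if "c \<in> region" "\<nexists>i c'. instr_step P i c c'" "i \<in> procs P" for c i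
    using region_stuck[OF that(1,2)] that(3) unfolding proc_cases by auto
qed (use region_step in blast)

end

section \<open>From queue machines to writers\<close>

type_synonym qstate = "nat \<times> nat \<times> nat"

datatype qinstr = Push nat qstate | Pop "nat \<Rightarrow> qstate"

text \<open>The second argument is the point within an instruction: 0 between instructions, 1
  halfway through a push, and the letter itself halfway through a pop. The halting state gets the
  code 0 of the target.\<close>

fun writer_code :: "qstate \<Rightarrow> nat \<Rightarrow> nat" where
  "writer_code (a, j, l) s = prod_encode (a, prod_encode (j, prod_encode (l, s)))"

lemma writer_code_eq [simp]: "writer_code q s = writer_code q' s' \<longleftrightarrow> q = q' \<and> s = s'"
  by (cases q; cases q') (simp add: prod_encode_eq)

lemma writer_code_0 [simp]: "writer_code (0, 0, 0) 0 = 0"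
  by (simp add: prod_encode_def)

lemma writer_code_eq_0 [simp]:
  "writer_code q s = 0 \<longleftrightarrow> q = (0, 0, 0) \<and> s = 0" "0 = writer_code q s \<longleftrightarrow> q = (0, 0, 0) \<and> s = 0"
  using writer_code_eq[of q s "(0, 0, 0)" 0] by (auto simp del: writer_code.simps writer_code_eq)

declare writer_code.simps [simp del]

text \<open>The separator \<open>(1, 1)\<close> puts variable 2 back to 1 after each letter. Letters
  are at least 2, so a writer in need of the next letter is blocked on 1 and reads no letter
  twice.\<close>

definition items :: "nat list \<Rightarrow> (nat \<times> nat) list" where
  "items w = concat (map (\<lambda>b. [(0, b), (1, 1)]) w)"

lemma items_simps [simp]:
  "items [] = []" "items (b # w) = (0, b) # (1, 1) # items w" "items (v @ w) = items v @ items w"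
  by (simp_all add: items_def)

locale queue_machine =
  fixes K :: nat and Q :: "qstate set" and code :: "qstate \<Rightarrow> qinstr"
  assumes finite_Q: "finite Q" and K_gt: "2 < K" and halt: "(0, 0, 0) \<notin> Q"
    and code_push: "\<And>q b q'. q \<in> Q \<Longrightarrow> code q = Push b q' \<Longrightarrow> 2 \<le> b \<and> b < K \<and> q' \<in> insert (0, 0, 0) Q"
    and code_pop: "\<And>q f b. q \<in> Q \<Longrightarrow> code q = Pop f \<Longrightarrow> 2 \<le> b \<Longrightarrow> b < K \<Longrightarrow> f b \<in> insert (0, 0, 0) Q"
begin

inductive qstep :: "qstate \<times> nat list \<Rightarrow> qstate \<times> nat list \<Rightarrow> bool" where
  push: "\<lbrakk>q \<in> Q; code q = Push b q'\<rbrakk> \<Longrightarrow> qstep (q, w) (q', w @ [b])"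
| pop: "\<lbrakk>q \<in> Q; code q = Pop f\<rbrakk> \<Longrightarrow> qstep (q, b # w) (f b, w)"

inductive_set writer_trans :: "(nat \<times> (nat, nat) instr \<times> nat) set" where
  "\<lbrakk>q \<in> Q; code q = Push b q'\<rbrakk> \<Longrightarrow> (writer_code q 0, Wr 0 b, writer_code q 1) \<in> writer_trans"
| "\<lbrakk>q \<in> Q; code q = Push b q'\<rbrakk> \<Longrightarrow> (writer_code q 1, Wr 1 1, writer_code q' 0) \<in> writer_trans"
| "\<lbrakk>q \<in> Q; code q = Pop f; 2 \<le> b; b < K\<rbrakk> \<Longrightarrow> (writer_code q 0, Rd 2 b, writer_code q b) \<in> writer_trans"
| "\<lbrakk>q \<in> Q; code q = Pop f; 2 \<le> b; b < K\<rbrakk> \<Longrightarrow> (writer_code q b, Rd 2 1, writer_code (f b) 0) \<in> writer_trans"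
| "(0, Skip, 0) \<in> writer_trans"

definition writer_states :: "nat set" where
  "writer_states = insert 0 (case_prod writer_code ` (Q \<times> {..<K}))"

lemma finite_writer_states: "finite writer_states"
  unfolding writer_states_def using finite_Q by simp

lemma writer_statesI [intro]:
  "0 \<in> writer_states" "q \<in> Q \<Longrightarrow> s < K \<Longrightarrow> writer_code q s \<in> writer_states"
  "q \<in> insert (0, 0, 0) Q \<Longrightarrow> writer_code q 0 \<in> writer_states"
  using K_gt unfolding writer_states_def by force+

lemma writer_trans_subset:
  assumes "K \<le> n"
  shows "writer_trans \<subseteq> writer_states \<times> instrs {..<3} {..<n} \<times> writer_states"
proof -
  have "s \<in> writer_states \<and> ins \<in> instrs {..<3} {..<n} \<and> s' \<in> writer_states"
    if "(s, ins, s') \<in> writer_trans" for s ins s'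
    using that
  proof cases
    case (1 q b q')
    have "2 \<le> b \<and> b < K" using code_push[OF 1(4,5)] by blast
    then show ?thesis using 1 assms K_gt by (auto simp: instrs_def)
  next
    case (2 q b q')
    have "q' \<in> insert (0, 0, 0) Q" using code_push[OF 2(4,5)] by blast
    then show ?thesis using 2 assms K_gt by (auto simp: instrs_def)
  next
    case (3 q f b)
    then show ?thesis using assms K_gt by (auto simp: instrs_def)
  next
    case (4 q f b)
    have "f b \<in> insert (0, 0, 0) Q" using code_pop[OF 4(4-)] by blast
    then show ?thesis using 4 assms K_gt by (auto simp: instrs_def)
  qed (auto simp: instrs_def)
  then show ?thesis by auto
qed

lemma writer_trans_cases:
  assumes "(q, ins, q') \<in> writer_trans"
  shows "(\<exists>v d. ins = Wr v d \<and> v < 2 \<and> 0 < d \<and> d < K) \<or> (\<exists>d. ins = Rd 2 d) \<or>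
      ins = Skip \<and> q = 0 \<and> q' = 0"
  using assms
proof cases
  case (1 q b q')
  have "2 \<le> b \<and> b < K" using code_push[OF 1(4,5)] by blast
  then show ?thesis using 1 by auto
qed (use K_gt in auto)

abbreviation letters :: "nat list \<Rightarrow> bool" where
  "letters w \<equiv> set w \<subseteq> {2..<K}"

lemma alternating_items_snoc:
  "letters w \<Longrightarrow> alternating K 0 v \<Longrightarrow> alternating K 0 (items w @ v)"
  using K_gt by (induction w) auto

lemma alternating_letters: "letters w \<Longrightarrow> alternating K 0 (items w)"
  using alternating_items_snoc[of w "[]"] by simp

lemma blocked_pop:
  assumes "q \<in> Q" "code q = Pop f"
  shows "blocked writer_trans (writer_code q 0) 1"
    "2 \<le> b \<Longrightarrow> blocked writer_trans (writer_code q b) b"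
proof -
  have q: "q \<noteq> (0, 0, 0)" using assms(1) halt by blast
  have "\<exists>e. ins = Rd 2 e \<and> e \<noteq> 1" if "(writer_code q 0, ins, s) \<in> writer_trans" for ins s
    using that by cases (use assms(2) q in auto)
  then show "blocked writer_trans (writer_code q 0) 1" unfolding blocked_def by blast
  assume b: "2 \<le> b"
  have "\<exists>e. ins = Rd 2 e \<and> e \<noteq> b" if "(writer_code q b, ins, s) \<in> writer_trans" for ins s
    using that by cases (use assms(2) q b in auto)
  then show "blocked writer_trans (writer_code q b) b" unfolding blocked_def by blast
qed

text \<open>A push is two sends. A pop is a delivery and a read for the letter and again for the
  separator, after which variable 2 and the parity are back at 1 and 0.\<close>

lemma qstep_reaches_target:
  assumes "qstep (q, w) (q', w')" "letters w"
    "reaches_target K writer_trans (writer_code q' 0) (items w') 1 0"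
  shows "reaches_target K writer_trans (writer_code q 0) (items w) 1 0"
  using assms(1)
proof cases
  case (push b)
  then have b: "2 \<le> b" "b < K" using code_push[OF push(2,3)] by auto
  have "reaches_target K writer_trans (writer_code q 1) (items w @ [(0, b)]) 1 0"
    by (rule reaches_target.send[OF writer_trans.intros(2)[OF push(2,3)]])
      (use assms(2,3) b push(1) K_gt in \<open>auto intro!: alternating_items_snoc\<close>)
  then show ?thesis
    by (rule reaches_target.send[OF writer_trans.intros(1)[OF push(2,3)], rotated])
      (use assms(2) b in \<open>auto intro!: alternating_items_snoc\<close>)
next
  case (pop f b)
  then have b: "2 \<le> b" "b < K" using assms(2) by auto
  have "reaches_target K writer_trans (writer_code q b) (items w') 1 0"
    by (rule reaches_target.get[OF writer_trans.intros(4)[OF pop(3,4) b]]) (use assms(3) pop in simp)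
  then have "reaches_target K writer_trans (writer_code q b) ((1, 1) # items w') b 1"
    by (intro reaches_target.deliver blocked_pop(2)[OF pop(3,4) b(1)]) simp
  then have "reaches_target K writer_trans (writer_code q 0) ((1, 1) # items w') b 1"
    by (rule reaches_target.get[OF writer_trans.intros(3)[OF pop(3,4) b]])
  then have "reaches_target K writer_trans (writer_code q 0) ((0, b) # (1, 1) # items w') 1 0"
    by (intro reaches_target.deliver blocked_pop(1)[OF pop(3,4)]) simp
  then show ?thesis using pop(1) by simp
qed

lemma qstep_letters: "qstep (q, w) (q', w') \<Longrightarrow> letters w \<Longrightarrow> letters w'"
  by (erule qstep.cases) (auto dest: code_push)

theorem halting_reaches_target:
  assumes "qstep\<^sup>*\<^sup>* (q, w) ((0, 0, 0), w')" "letters w"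
  shows "reaches_target K writer_trans (writer_code q 0) (items w) 1 0"
  using assms
proof (induction "(q, w)" arbitrary: q w rule: converse_rtranclp_induct)
  case base
  then show ?case by (simp add: reaches_target.target)
next
  case (step y)
  then show ?case using qstep_reaches_target qstep_letters by (metis prod.exhaust)
qed

section \<open>Nonhalting queue machines as safe writers\<close>

definition safe :: "qstate \<Rightarrow> nat list \<Rightarrow> bool" where
  "safe q w \<longleftrightarrow> q \<in> Q \<and> letters w \<and> (\<nexists>w'. qstep\<^sup>*\<^sup>* (q, w) ((0, 0, 0), w'))"

lemma safe_step:
  assumes "safe q w" "qstep (q, w) (q', w')"
  shows "safe q' w'"
proof -
  have "q' \<in> insert (0, 0, 0) Q"
    using assms(2) by cases (use assms(1) in \<open>auto simp: safe_def dest: code_push code_pop\<close>)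
  moreover have no: "\<nexists>v. qstep\<^sup>*\<^sup>* (q', w') ((0, 0, 0), v)"
    using assms unfolding safe_def by (meson converse_rtranclp_into_rtranclp)
  then have "q' \<noteq> (0, 0, 0)" by blast
  ultimately show ?thesis using no assms qstep_letters unfolding safe_def by blast
qed

text \<open>These are the points that writer and relay can reach within one queue instruction. A
  push counts from its second message on, and a popped letter stays in the abstract queue until its
  separator has been read, so safety is always that of a proper queue configuration.\<close>

inductive safe_writer_state :: "nat \<Rightarrow> (nat \<times> nat) list \<Rightarrow> nat \<Rightarrow> nat \<Rightarrow> bool" where
  "safe q w \<Longrightarrow> safe_writer_state (writer_code q 0) (items w) 1 0"
| "\<lbrakk>safe q w; code q = Push b q'\<rbrakk> \<Longrightarrow>
    safe_writer_state (writer_code q 1) (items w @ [(0, b)]) 1 0"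
| "\<lbrakk>safe q (b # w); code q = Pop f\<rbrakk> \<Longrightarrow>
    safe_writer_state (writer_code q 0) ((1, 1) # items w) b 1"
| "\<lbrakk>safe q (b # w); code q = Pop f\<rbrakk> \<Longrightarrow>
    safe_writer_state (writer_code q b) ((1, 1) # items w) b 1"
| "\<lbrakk>safe q (b # w); code q = Pop f\<rbrakk> \<Longrightarrow>
    safe_writer_state (writer_code q b) (items w) 1 0"

lemma safe_basic:
  assumes "safe_writer_state q u z p"
  shows "q \<noteq> 0 \<and> p < 2 \<and> alternating K p u"
  using assms
proof cases
  case (2 q w b q')
  then show ?thesis using halt code_push[of q b q'] alternating_items_snoc[of w "[(0, b)]"]
    unfolding safe_def by auto
qed (use halt K_gt in \<open>auto simp: safe_def alternating_letters\<close>)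

lemma safe_send:
  assumes "safe_writer_state q u z p" "(q, Wr v d, q') \<in> writer_trans"
  shows "safe_writer_state q' (u @ [(v, d)]) z p"
  using assms(2)
proof cases
  case (1 r r')
  from assms(1) show ?thesis
    by cases (use 1 in \<open>auto intro: safe_writer_state.intros[simplified]\<close>)
next
  case (2 r b r')
  from assms(1) show ?thesis
  proof cases
    case (2 r1 w b1 r1')
    then have "safe r' (w @ [b])"
      using safe_step qstep.push \<open>r \<in> Q\<close> \<open>code r = Push b r'\<close> \<open>q = writer_code r 1\<close> by auto
    then show ?thesis using 2 \<open>code r = Push b r'\<close> \<open>q = writer_code r 1\<close> \<open>v = 1\<close> \<open>d = 1\<close>
        \<open>q' = writer_code r' 0\<close> safe_writer_state.intros(1)[of r' "w @ [b]"] by simp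
  qed (use 2 in \<open>auto simp: safe_def\<close>)
qed

lemma safe_get:
  assumes "safe_writer_state q u z p" "(q, Rd 2 z, q') \<in> writer_trans"
  shows "safe_writer_state q' u z p"
  using assms(2)
proof cases
  case (3 r f)
  from assms(1) show ?thesis
    by cases (use 3 in \<open>auto intro: safe_writer_state.intros[simplified]\<close>)
next
  case (4 r f b)
  from assms(1) show ?thesis
  proof cases
    case (5 r1 b1 w f1)
    then have "safe (f b) w"
      using safe_step qstep.pop 4 by auto
    then show ?thesis using 4 5 safe_writer_state.intros(1) by simp
  qed (use 4 in \<open>auto simp: safe_def\<close>)
qed

lemma not_blocked_get: "(q, Rd 2 z, q') \<in> \<delta> \<Longrightarrow> \<not> blocked \<delta> q z"
  unfolding blocked_def by blast

lemma not_blocked_send: "(q, Wr v d, q') \<in> \<delta> \<Longrightarrow> \<not> blocked \<delta> q z"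
  unfolding blocked_def by blast

text \<open>Blocking excludes a push under way and a forwarded value not yet read. What remains is a
  pop waiting for its letter or for its separator.\<close>

lemma safe_deliver:
  assumes "safe_writer_state q ((p, d) # u) z p" "blocked writer_trans q z"
  shows "safe_writer_state q u d (1 - p)"
  using assms(1)
proof cases
  case (1 r w)
  then obtain b w' where w: "w = b # w'" by (cases w) auto
  have "r \<in> Q" using 1 unfolding safe_def by blast
  show ?thesis
  proof (cases "code r")
    case (Push c r')
    then show ?thesis
      using 1 assms(2) not_blocked_send writer_trans.intros(1)[OF \<open>r \<in> Q\<close> Push] by blast
  next
    case (Pop f)
    then show ?thesis using 1 w safe_writer_state.intros(3)[of r b w' f] by simp
  qed
next
  case (2 r w b r')
  then show ?thesis
    using assms(2) not_blocked_send writer_trans.intros(2)[of r b r'] unfolding safe_def by blast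
next
  case (3 r w f)
  then show ?thesis
    using assms(2) not_blocked_get writer_trans.intros(3)[of r f z] unfolding safe_def by auto
next
  case (4 r w f)
  then show ?thesis using safe_writer_state.intros(5) by simp
next
  case (5 r b w f)
  then show ?thesis
    using assms(2) not_blocked_get writer_trans.intros(4)[of r f b] unfolding safe_def by auto
qed

end

section \<open>Recursive functions as loop programs\<close>

text \<open>\<open>Loop r p\<close> tests and decrements \<open>r\<close> before each turn. The body
  may increment \<open>r\<close>, so a loop can run forever and unbounded search is
  expressible.\<close>

datatype loop_program = Inc nat | Seq loop_program loop_program | Loop nat loop_program

inductive exec :: "loop_program \<Rightarrow> (nat \<Rightarrow> nat) \<Rightarrow> (nat \<Rightarrow> nat) \<Rightarrow> bool" where
  inc: "exec (Inc r) s (s(r := Suc (s r)))"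
| seq: "\<lbrakk>exec p s t; exec q t u\<rbrakk> \<Longrightarrow> exec (Seq p q) s u"
| stop: "s r = 0 \<Longrightarrow> exec (Loop r p) s s"
| iter: "\<lbrakk>s r = Suc m; exec p (s(r := m)) t; exec (Loop r p) t u\<rbrakk> \<Longrightarrow> exec (Loop r p) s u"

lemma exec_cong: "exec p s t \<Longrightarrow> t = t' \<Longrightarrow> exec p s t'"
  by simp

text \<open>A loop on a register known to be zero stands in for the missing empty program. On a
  nonzero register the same loop never ends.\<close>

definition nop :: "nat \<Rightarrow> loop_program" where
  "nop b = Loop b (Inc b)"

lemma exec_nop: "s b = 0 \<Longrightarrow> exec (nop b) s s"
  unfolding nop_def by (rule exec.stop)

definition move_register :: "nat \<Rightarrow> nat \<Rightarrow> loop_program" where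
  "move_register r out = Loop r (Inc out)"

lemma exec_move_register:
  assumes "r \<noteq> out"
  shows "exec (move_register r out) s (s(r := 0, out := s out + s r))"
proof (induction "s r" arbitrary: s)
  case 0
  then show ?case unfolding move_register_def by (intro exec_cong[OF exec.stop]) auto
next
  case (Suc m)
  let ?s = "s(r := m)"
  let ?t = "?s(out := Suc (?s out))"
  have "exec (move_register r out) ?t (?t(r := 0, out := ?t out + ?t r))"
    using Suc.hyps(1)[of ?t] assms by simp
  then have "exec (move_register r out) s (?t(r := 0, out := ?t out + ?t r))"
    unfolding move_register_def by (rule exec.iter[where s = s and r = r and m = m, OF Suc.hyps(2)[symmetric] exec.inc])
  then show ?case by (rule exec_cong) (use assms Suc.hyps(2) in auto)
qed

definition clear_register :: "nat \<Rightarrow> nat \<Rightarrow> loop_program" where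
  "clear_register r b = Loop r (nop b)"

lemma exec_clear_register:
  assumes "s b = 0" "r \<noteq> b"
  shows "exec (clear_register r b) s (s(r := 0))"
  using assms(1)
proof (induction "s r" arbitrary: s)
  case 0
  then show ?case unfolding clear_register_def by (intro exec_cong[OF exec.stop]) auto
next
  case (Suc m)
  let ?s = "s(r := m)"
  have "exec (clear_register r b) ?s (?s(r := 0))"
    using Suc.hyps(1)[of ?s] Suc.prems assms(2) by simp
  moreover have "exec (nop b) ?s ?s" using Suc.prems assms(2) by (intro exec_nop) simp
  ultimately have "exec (clear_register r b) s (?s(r := 0))"
    unfolding clear_register_def by (intro exec.iter[where s = s and r = r and m = m, OF Suc.hyps(2)[symmetric]])
  then show ?case by simp
qed

definition copy_register :: "nat \<Rightarrow> nat \<Rightarrow> nat \<Rightarrow> loop_program" where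
  "copy_register r out t = Seq (move_register r t) (Loop t (Seq (Inc r) (Inc out)))"

lemma exec_copy_register:
  assumes "s t = 0" "distinct [r, out, t]"
  shows "exec (copy_register r out t) s (s(out := s out + s r))"
proof -
  have loop: "exec (Loop t (Seq (Inc r) (Inc out))) s (s(t := 0, r := s r + s t, out := s out + s t))"
    for s
  proof (induction "s t" arbitrary: s)
    case 0
    then show ?case by (intro exec_cong[OF exec.stop]) auto
  next
    case (Suc m)
    let ?s = "s(t := m)"
    let ?u = "?s(r := Suc (?s r))"
    let ?v = "?u(out := Suc (?u out))"
    have "exec (Loop t (Seq (Inc r) (Inc out))) ?v (?v(t := 0, r := ?v r + ?v t, out := ?v out + ?v t))"
      using Suc.hyps(1)[of ?v] assms(2) by simp
    then have "exec (Loop t (Seq (Inc r) (Inc out))) s (?v(t := 0, r := ?v r + ?v t, out := ?v out + ?v t))"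
      by (rule exec.iter[where s = s and r = t and m = m, OF Suc.hyps(2)[symmetric] exec.seq[OF exec.inc exec.inc]])
    then show ?case by (rule exec_cong) (use assms(2) Suc.hyps(2) in auto)
  qed
  have "r \<noteq> t" using assms(2) by auto
  show ?thesis unfolding copy_register_def
    by (rule exec_cong[OF exec.seq[OF exec_move_register[OF \<open>r \<noteq> t\<close>] loop]]) (use assms in auto)
qed

fun clear_all :: "nat list \<Rightarrow> nat \<Rightarrow> loop_program" where
  "clear_all [] b = nop b"
| "clear_all (r # rs) b = Seq (clear_register r b) (clear_all rs b)"

lemma exec_clear_all:
  "s b = 0 \<Longrightarrow> b \<notin> set rs \<Longrightarrow> exec (clear_all rs b) s (\<lambda>r. if r \<in> set rs then 0 else s r)"
proof (induction rs arbitrary: s)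
  case Nil
  then show ?case by (simp add: exec_nop)
next
  case (Cons r rs)
  have 1: "exec (clear_register r b) s (s(r := 0))" using Cons.prems by (intro exec_clear_register) auto
  have "exec (clear_all rs b) (s(r := 0)) (\<lambda>r'. if r' \<in> set rs then 0 else (s(r := 0)) r')"
    using Cons.prems by (intro Cons.IH) auto
  from exec.seq[OF 1 this] show ?case unfolding clear_all.simps by (rule exec_cong) auto
qed

fun run_all :: "(nat list \<Rightarrow> nat \<Rightarrow> nat \<Rightarrow> loop_program) list \<Rightarrow> nat list \<Rightarrow> nat \<Rightarrow> nat \<Rightarrow> loop_program" where
  "run_all [] rs out b = nop b"
| "run_all (h # hs) rs out b = Seq (h rs out b) (run_all hs rs (Suc out) b)"

text \<open>\<open>compile f rs out b\<close> adds the value of \<open>f\<close> on the registers \<open>rs\<close> to \<open>out\<close>. The registers from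
  \<open>b\<close> on are scratch space, zero before and after.\<close>

primrec compile :: "recf \<Rightarrow> nat list \<Rightarrow> nat \<Rightarrow> nat \<Rightarrow> loop_program" where
  "compile Zero = (\<lambda>rs out b. nop b)"
| "compile Succ = (\<lambda>rs out b. Seq (copy_register (hd rs) out b) (Inc out))"
| "compile (Proj k) = (\<lambda>rs out b. copy_register (rs ! k) out b)"
| "compile (Comp f gs) = (\<lambda>rs out b.
    Seq (run_all (map compile gs) rs b (b + length gs))
      (Seq (compile f [b..<b + length gs] out (b + length gs))
        (clear_all [b..<b + length gs] (b + length gs))))"
| "compile (PrimRec f g) = (\<lambda>rs out b.
    Seq (compile f (tl rs) b (b + 4))
      (Seq (copy_register (hd rs) (b + 2) (b + 3))
        (Seq
          (Loop (b + 2)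
            (Seq (compile g ((b + 1) # b # tl rs) (b + 3) (b + 4))
              (Seq (clear_register b (b + 4)) (Seq (move_register (b + 3) b) (Inc (b + 1))))))
          (Seq (move_register b out) (clear_register (b + 1) (b + 4))))))"
| "compile (Mu f) = (\<lambda>rs out b.
    Seq (compile f (b # rs) (b + 1) (b + 2))
      (Seq
        (Loop (b + 1)
          (Seq (clear_register (b + 1) (b + 2)) (Seq (Inc b) (compile f (b # rs) (b + 1) (b + 2)))))
        (move_register b out)))"

text \<open>Only defined values are described: the diagonal run takes place on an argument where the
  decision procedure halts. The input registers avoid \<open>out\<close> because a register is
  copied only to a different one.\<close>

definition correct :: "recf \<Rightarrow> (nat list \<Rightarrow> nat \<Rightarrow> nat \<Rightarrow> loop_program) \<Rightarrow> bool" where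
  "correct f h \<longleftrightarrow> (\<forall>rs out b s y. computes f (map s rs) y \<longrightarrow> out < b \<longrightarrow> set rs \<subseteq> {..<b} - {out} \<longrightarrow>
     (\<forall>r\<ge>b. s r = 0) \<longrightarrow> exec (h rs out b) s (s(out := s out + y)))"

lemma correctD:
  assumes "correct f h" "computes f (map s rs) y" "out < b" "set rs \<subseteq> {..<b} - {out}"
    "\<And>r. b \<le> r \<Longrightarrow> s r = 0"
  shows "exec (h rs out b) s (s(out := s out + y))"
  using assms unfolding correct_def by blast

lemma exec_run_all:
  assumes "list_all2 (\<lambda>g y. computes g (map s rs) y) gs ys" "\<And>g. g \<in> set gs \<Longrightarrow> correct g (h g)"
    "out + length gs \<le> b" "set rs \<subseteq> {..<out}" "\<And>r. b \<le> r \<Longrightarrow> s r = 0"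
  shows "exec (run_all (map h gs) rs out b) s
    (\<lambda>r. if out \<le> r \<and> r < out + length gs then s r + ys ! (r - out) else s r)"
  using assms
proof (induction gs arbitrary: ys out s)
  case Nil
  show ?case unfolding list.map run_all.simps
    by (rule exec_cong[OF exec_nop]) (use Nil in auto)
next
  case (Cons g gs)
  then obtain y ys' where ys: "ys = y # ys'" "computes g (map s rs) y"
      "list_all2 (\<lambda>g y. computes g (map s rs) y) gs ys'"
    by (auto simp: list_all2_Cons1)
  let ?s = "s(out := s out + y)"
  have 1: "exec (h g rs out b) s ?s"
    using Cons.prems ys(2) by (intro correctD[of g]) auto
  have "map ?s rs = map s rs" using Cons.prems(4) by auto
  then have "list_all2 (\<lambda>g y. computes g (map ?s rs) y) gs ys'" using ys(3) by presburger
  then have 2: "exec (run_all (map h gs) rs (Suc out) b) ?s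
      (\<lambda>r. if Suc out \<le> r \<and> r < Suc out + length gs then ?s r + ys' ! (r - Suc out) else ?s r)"
    by (rule Cons.IH) (use Cons.prems in \<open>auto simp: subset_iff less_Suc_eq\<close>)
  show ?case unfolding list.map run_all.simps
    by (rule exec_cong[OF exec.seq[OF 1 2]]) (auto simp: ys(1) nth_Cons' fun_eq_iff)
qed

inductive_cases computes_Zero: "computes Zero xs y"
inductive_cases computes_Succ: "computes Succ xs y"
inductive_cases computes_Proj: "computes (Proj k) xs y"
inductive_cases computes_Comp: "computes (Comp f gs) xs y"
inductive_cases computes_Mu: "computes (Mu f) xs y"
inductive_cases computes_PrimRec: "computes (PrimRec f g) xs y"
inductive_cases computes_PrimRec_0: "computes (PrimRec f g) (0 # xs) y"
inductive_cases computes_PrimRec_Suc: "computes (PrimRec f g) (Suc n # xs) y"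

text \<open>A derivation unfolds the recursion from \<open>n\<close> downwards, whereas the compiled
  loop counts upwards; its invariant refers to the sequence \<open>v\<close> of intermediate
  values.\<close>

lemma computes_PrimRec_values:
  "computes (PrimRec f g) (n # xs) y \<Longrightarrow> \<exists>v. computes f xs (v 0) \<and> v n = y \<and>
     (\<forall>i<n. computes g (i # v i # xs) (v (Suc i)))"
proof (induction n arbitrary: y)
  case 0
  then have "computes f xs y" by (rule computes_PrimRec_0)
  then show ?case by (intro exI[of _ "\<lambda>_. y"]) simp
next
  case (Suc n)
  from Suc.prems obtain r where r: "computes (PrimRec f g) (n # xs) r" "computes g (n # r # xs) y"
    by (rule computes_PrimRec_Suc)
  from Suc.IH[OF r(1)] obtain v where v: "computes f xs (v 0)" "v n = r"
      "\<forall>i<n. computes g (i # v i # xs) (v (Suc i))" by blast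
  show ?case
    using v r(2) by (intro exI[of _ "v(Suc n := y)"]) (auto simp: less_Suc_eq)
qed

lemma correct_Comp:
  assumes f: "correct f (compile f)" and gs: "\<And>g. g \<in> set gs \<Longrightarrow> correct g (compile g)"
  shows "correct (Comp f gs) (compile (Comp f gs))"
  unfolding correct_def
proof (intro allI impI)
  fix rs :: "nat list" and out b :: nat and s :: "nat \<Rightarrow> nat" and z :: nat
  assume "computes (Comp f gs) (map s rs) z" and out: "out < b" and rs: "set rs \<subseteq> {..<b} - {out}"
    and zero: "\<forall>r\<ge>b. s r = 0"
  then obtain ys where ys: "list_all2 (\<lambda>g y. computes g (map s rs) y) gs ys" "computes f ys z"
    by (elim computes_Comp)
  let ?m = "length gs"
  have len: "length ys = ?m" using ys(1) by (simp add: list_all2_lengthD)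
  let ?t = "\<lambda>r. if b \<le> r \<and> r < b + ?m then s r + ys ! (r - b) else s r"
  have 1: "exec (run_all (map compile gs) rs b (b + ?m)) s ?t"
    using ys(1) gs rs zero by (intro exec_run_all) auto
  have "map ?t [b..<b + ?m] = ys"
    using len zero by (intro nth_equalityI) auto
  then have 2: "exec (compile f [b..<b + ?m] out (b + ?m)) ?t (?t(out := ?t out + z))"
    using ys(2) out zero by (intro correctD[OF f]) auto
  have 3: "exec (clear_all [b..<b + ?m] (b + ?m)) (?t(out := ?t out + z))
      (\<lambda>r. if r \<in> set [b..<b + ?m] then 0 else (?t(out := ?t out + z)) r)"
    using out zero by (intro exec_clear_all) auto
  show "exec (compile (Comp f gs) rs out b) s (s(out := s out + z))"
    unfolding compile.simps
    by (rule exec_cong[OF exec.seq[OF 1 exec.seq[OF 2 3]]]) (use out zero in \<open>auto simp: fun_eq_iff\<close>)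
qed

lemma correct_PrimRec:
  assumes f: "correct f (compile f)" and g: "correct g (compile g)"
  shows "correct (PrimRec f g) (compile (PrimRec f g))"
  unfolding correct_def
proof (intro allI impI)
  fix rs :: "nat list" and out b :: nat and s :: "nat \<Rightarrow> nat" and y :: nat
  assume comp: "computes (PrimRec f g) (map s rs) y" and out: "out < b"
    and rs: "set rs \<subseteq> {..<b} - {out}" and zero: "\<forall>r\<ge>b. s r = 0"
  obtain r0 rs' where rs': "rs = r0 # rs'"
    using comp by (cases rs) (auto elim: computes_PrimRec)
  let ?xs = "map s rs'"
  let ?n = "s r0"
  obtain v where v: "computes f ?xs (v 0)" "v ?n = y"
      "\<And>i. i < ?n \<Longrightarrow> computes g (i # v i # ?xs) (v (Suc i))"
    using computes_PrimRec_values[of f g ?n ?xs y] comp rs' by auto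
  have r0: "r0 < b" "r0 \<noteq> out" and below: "\<And>r. r \<in> set rs' \<Longrightarrow> r < b \<and> r \<noteq> out"
    using rs unfolding rs' by auto
  \<comment> \<open>The state after \<open>i\<close> turns: accumulator, counter and number of
    remaining turns. Register \<open>b + 3\<close> receives the next value and is zero in
    between.\<close>
  define \<sigma> where "\<sigma> i = s(b := v i, b + 1 := i, b + 2 := ?n - i)" for i
  have 1: "exec (compile f rs' b (b + 4)) s (s(b := v 0))"
    using correctD[OF f v(1), of b "b + 4"] below zero by (force simp: subset_iff)
  have 2: "exec (copy_register r0 (b + 2) (b + 3)) (s(b := v 0)) (\<sigma> 0)"
    by (rule exec_cong[OF exec_copy_register]) (use zero r0 in \<open>auto simp: \<sigma>_def fun_eq_iff\<close>)
  let ?body = "Seq (compile g ((b + 1) # b # rs') (b + 3) (b + 4))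
    (Seq (clear_register b (b + 4)) (Seq (move_register (b + 3) b) (Inc (b + 1))))"
  have body: "exec ?body ((\<sigma> i)(b + 2 := m)) (\<sigma> (Suc i))" if i: "?n - i = Suc m" for i m
  proof -
    let ?s = "(\<sigma> i)(b + 2 := m)"
    have "map ?s rs' = ?xs"
      by (rule map_cong[OF refl]) (auto simp: \<sigma>_def dest: below)
    then have args: "map ?s ((b + 1) # b # rs') = i # v i # ?xs"
      unfolding list.map by (simp add: \<sigma>_def del: map_eq_conv)
    have "i < ?n" using i by simp
    then have "computes g (map ?s ((b + 1) # b # rs')) (v (Suc i))"
      unfolding args by (rule v(3))
    then have a: "exec (compile g ((b + 1) # b # rs') (b + 3) (b + 4)) ?s
        (?s(b + 3 := ?s (b + 3) + v (Suc i)))"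
      using below zero by (intro correctD[OF g]) (force simp: \<sigma>_def subset_iff)+
    let ?t = "?s(b + 3 := ?s (b + 3) + v (Suc i))"
    have c: "exec (clear_register b (b + 4)) ?t (?t(b := 0))"
      by (rule exec_clear_register) (use zero in \<open>auto simp: \<sigma>_def\<close>)
    have "b + 3 \<noteq> b" by simp
    show ?thesis
      by (rule exec_cong[OF exec.seq[OF a exec.seq[OF c exec.seq[OF exec_move_register[OF \<open>b + 3 \<noteq> b\<close>] exec.inc]]]])
        (use i zero in \<open>auto simp: \<sigma>_def fun_eq_iff\<close>)
  qed
  have 3: "exec (Loop (b + 2) ?body) (\<sigma> i) (\<sigma> ?n)" if "i \<le> ?n" for i
    using that
  proof (induction i rule: inc_induct)
    case base
    show ?case by (rule exec.stop) (simp add: \<sigma>_def)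
  next
    case (step i)
    then obtain m where m: "?n - i = Suc m" by (metis Suc_diff_Suc)
    then have "\<sigma> i (b + 2) = Suc m" by (simp add: \<sigma>_def)
    then show ?case using body[OF m] step.IH by (rule exec.iter)
  qed
  have "b \<noteq> out" using out by simp
  note 4 = exec_move_register[OF this]
  have 5: "exec (clear_register (b + 1) (b + 4)) t (t(b + 1 := 0))" if "t (b + 4) = 0" for t
    using that by (intro exec_clear_register) auto
  show "exec (compile (PrimRec f g) rs out b) s (s(out := s out + y))"
    unfolding compile.simps rs' list.sel
    by (rule exec_cong[OF exec.seq[OF 1 exec.seq[OF 2 exec.seq[OF 3 exec.seq[OF 4 5]]]]])
      (use zero out v(2) in \<open>auto simp: \<sigma>_def fun_eq_iff\<close>)
qed

lemma correct_Mu: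
  assumes f: "correct f (compile f)"
  shows "correct (Mu f) (compile (Mu f))"
  unfolding correct_def
proof (intro allI impI)
  fix rs :: "nat list" and out b :: nat and s :: "nat \<Rightarrow> nat" and n :: nat
  assume comp: "computes (Mu f) (map s rs) n" and out: "out < b"
    and rs: "set rs \<subseteq> {..<b} - {out}" and zero: "\<forall>r\<ge>b. s r = 0"
  let ?xs = "map s rs"
  from comp have "computes f (n # ?xs) 0" "\<forall>k<n. \<exists>r. computes f (k # ?xs) (Suc r)"
    by (auto elim: computes_Mu)
  then have "\<forall>k\<le>n. \<exists>r. computes f (k # ?xs) r \<and> (r = 0 \<longleftrightarrow> k = n)"
    by (metis le_neq_implies_less nat.simps(3) order.strict_implies_not_eq)
  then obtain v where v: "\<And>k. k \<le> n \<Longrightarrow> computes f (k # ?xs) (v k)" "\<And>k. k \<le> n \<Longrightarrow> v k = 0 \<longleftrightarrow> k = n"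
    by metis
  \<comment> \<open>The candidate \<open>i\<close>, with its value under \<open>f\<close> in the
    register that controls the loop. The values before \<open>n\<close> are positive and the one at
    \<open>n\<close> is zero, so the loop stops at \<open>n\<close>.\<close>
  define \<sigma> where "\<sigma> i = s(b := i, b + 1 := v i)" for i
  have run: "exec (compile f (b # rs) (b + 1) (b + 2)) (s(b := i)) (\<sigma> i)" if i: "i \<le> n" for i
  proof -
    have args: "map (s(b := i)) (b # rs) = i # ?xs" using rs by auto
    have "computes f (map (s(b := i)) (b # rs)) (v i)" unfolding args by (rule v(1)[OF i])
    then have "exec (compile f (b # rs) (b + 1) (b + 2)) (s(b := i))
        ((s(b := i))(b + 1 := (s(b := i)) (b + 1) + v i))"
      by (rule correctD[OF f]) (use rs zero in \<open>auto simp: subset_iff\<close>)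
    then show ?thesis by (rule exec_cong) (use zero in \<open>auto simp: \<sigma>_def fun_eq_iff\<close>)
  qed
  have 1: "exec (compile f (b # rs) (b + 1) (b + 2)) s (\<sigma> 0)"
  proof -
    have "s(b := 0) = s" using zero by (auto simp: fun_eq_iff)
    then show ?thesis using run[of 0] by simp
  qed
  let ?body = "Seq (clear_register (b + 1) (b + 2)) (Seq (Inc b) (compile f (b # rs) (b + 1) (b + 2)))"
  have 2: "exec (Loop (b + 1) ?body) (\<sigma> i) (\<sigma> n)" if "i \<le> n" for i
    using that
  proof (induction i rule: inc_induct)
    case base
    show ?case by (rule exec.stop) (use v(2)[of n] in \<open>simp add: \<sigma>_def\<close>)
  next
    case (step i)
    then obtain m where m: "v i = Suc m" using v(2)[of i] by (cases "v i") auto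
    let ?s = "(\<sigma> i)(b + 1 := m)"
    have c: "exec (clear_register (b + 1) (b + 2)) ?s (?s(b + 1 := 0))"
      by (rule exec_clear_register) (use zero in \<open>auto simp: \<sigma>_def\<close>)
    let ?t = "?s(b + 1 := 0)"
    have "?t(b := Suc (?t b)) = s(b := Suc i)"
      using zero by (auto simp: \<sigma>_def fun_eq_iff)
    then have "exec (Inc b) ?t (s(b := Suc i))" using exec.inc[of b ?t] by simp
    then have "exec ?body ?s (\<sigma> (Suc i))"
      using exec.seq[OF c exec.seq[OF _ run[of "Suc i"]]] step.hyps by simp
    moreover have "\<sigma> i (b + 1) = Suc m" using m by (simp add: \<sigma>_def)
    ultimately show ?case using step.IH by (metis exec.iter)
  qed
  have "b \<noteq> out" using out by simp
  note 3 = exec_move_register[OF this]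
  show "exec (compile (Mu f) rs out b) s (s(out := s out + n))"
    unfolding compile.simps
    by (rule exec_cong[OF exec.seq[OF 1 exec.seq[OF 2 3]]])
      (use zero out v(2)[of n] in \<open>auto simp: \<sigma>_def fun_eq_iff\<close>)
qed

theorem compile_correct: "correct f (compile f)"
proof (induction f)
  case Zero
  show ?case unfolding correct_def
    by (auto elim!: computes_Zero intro!: exec_cong[OF exec_nop])
next
  case Succ
  show ?case unfolding correct_def
  proof (intro allI impI)
    fix rs :: "nat list" and out b :: nat and s :: "nat \<Rightarrow> nat" and y :: nat
    assume *: "computes Succ (map s rs) y" "out < b" "set rs \<subseteq> {..<b} - {out}" "\<forall>r\<ge>b. s r = 0"
    from *(1) obtain r where r: "rs = [r]" "y = Suc (s r)"
      by (auto elim!: computes_Succ)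
    then have "exec (copy_register r out b) s (s(out := s out + s r))"
      using * by (intro exec_copy_register) auto
    from exec.seq[OF this exec.inc[of out]] show "exec (compile Succ rs out b) s (s(out := s out + y))"
      using r by (auto intro: exec_cong)
  qed
next
  case (Proj k)
  show ?case unfolding correct_def
  proof (intro allI impI)
    fix rs :: "nat list" and out b :: nat and s :: "nat \<Rightarrow> nat" and y :: nat
    assume *: "computes (Proj k) (map s rs) y" "out < b" "set rs \<subseteq> {..<b} - {out}" "\<forall>r\<ge>b. s r = 0"
    from *(1) have k: "k < length rs" "y = s (rs ! k)" by (auto elim!: computes_Proj)
    then have "rs ! k \<in> {..<b} - {out}" using *(3) nth_mem by blast
    then show "exec (compile (Proj k) rs out b) s (s(out := s out + y))"
      unfolding compile.simps k(2) using * by (intro exec_copy_register) auto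
  qed
qed (simp_all add: correct_Comp correct_PrimRec correct_Mu del: compile.simps)

section \<open>From loop programs to queue machines\<close>

text \<open>Determinism forces a step from any point that can still reach \<open>X\<close> to follow
  its path into \<open>X\<close>, and progress keeps such a path nonempty. So the run stays in the
  set \<open>Y\<close> of these points, which excludes \<open>h\<close>.\<close>

lemma never_reaches_final:
  assumes det: "\<And>x y z. R x y \<Longrightarrow> R x z \<Longrightarrow> y = z" and final: "\<And>y. \<not> R h y"
    and progress: "\<And>x. x \<in> X \<Longrightarrow> \<exists>y\<in>X. R\<^sup>+\<^sup>+ x y" and c: "R\<^sup>*\<^sup>* c x" "x \<in> X"
  shows "\<not> R\<^sup>*\<^sup>* c h"
proof
  define Y where "Y = {y. \<exists>x\<in>X. R\<^sup>*\<^sup>* y x}"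
  have closed: "z \<in> Y" if y: "y \<in> Y" "R y z" for y z
  proof -
    have "\<exists>x\<in>X. R\<^sup>+\<^sup>+ y x"
    proof -
      obtain x where x: "x \<in> X" "R\<^sup>*\<^sup>* y x" using y(1) unfolding Y_def by blast
      obtain x' where "x' \<in> X" "R\<^sup>+\<^sup>+ x x'" using progress[OF x(1)] by blast
      then show ?thesis using x(2) by (meson rtranclp_tranclp_tranclp)
    qed
    then obtain x where x: "x \<in> X" "R\<^sup>+\<^sup>+ y x" by blast
    from x(2) obtain z' where "R y z'" "R\<^sup>*\<^sup>* z' x" by (meson tranclpD)
    then show ?thesis using det[OF y(2)] x(1) unfolding Y_def by blast
  qed
  assume "R\<^sup>*\<^sup>* c h"
  moreover have "c \<in> Y" using c unfolding Y_def by blast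
  ultimately have "h \<in> Y" by induction (use closed in blast)+
  then obtain x where x: "x \<in> X" "R\<^sup>*\<^sup>* h x" unfolding Y_def by blast
  then have "h = x" using final by (meson converse_rtranclpE)
  then show False using progress x(1) final by (meson tranclpD)
qed

section \<open>Flat counter programs\<close>

datatype counter_instr = FInc nat nat | FDec nat nat nat

fun program_size :: "loop_program \<Rightarrow> nat" where
  "program_size (Inc r) = 1"
| "program_size (Seq p q) = program_size p + program_size q"
| "program_size (Loop r p) = Suc (program_size p)"

fun max_register :: "loop_program \<Rightarrow> nat" where
  "max_register (Inc r) = r"
| "max_register (Seq p q) = max (max_register p) (max_register q)"
| "max_register (Loop r p) = max r (max_register p)"

text \<open>\<open>flat p a k\<close> places the code of \<open>p\<close> at the addresses from \<open>a\<close> on and continues at \<open>k\<close>.\<close>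

fun flat :: "loop_program \<Rightarrow> nat \<Rightarrow> nat \<Rightarrow> nat \<Rightarrow> counter_instr" where
  "flat (Inc r) a k x = FInc r k"
| "flat (Seq p q) a k x =
     (if x < a + program_size p then flat p a (a + program_size p) x
      else flat q (a + program_size p) k x)"
| "flat (Loop r p) a k x = (if x = a then FDec r (Suc a) k else flat p (Suc a) a x)"

fun implements :: "(nat \<Rightarrow> counter_instr) \<Rightarrow> loop_program \<Rightarrow> nat \<Rightarrow> nat \<Rightarrow> bool" where
  "implements cd (Inc r) a k \<longleftrightarrow> cd a = FInc r k"
| "implements cd (Seq p q) a k \<longleftrightarrow>
     implements cd p a (a + program_size p) \<and> implements cd q (a + program_size p) k"
| "implements cd (Loop r p) a k \<longleftrightarrow> cd a = FDec r (Suc a) k \<and> implements cd p (Suc a) a"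

lemma program_size_pos: "0 < program_size p"
  by (induction p) auto

lemma implements_flat:
  "(\<And>x. a \<le> x \<Longrightarrow> x < a + program_size p \<Longrightarrow> cd x = flat p a k x) \<Longrightarrow> implements cd p a k"
proof (induction p arbitrary: a k)
  case (Seq p q)
  have "implements cd p a (a + program_size p)" by (rule Seq.IH(1)) (simp add: Seq.prems)
  moreover have "implements cd q (a + program_size p) k" by (rule Seq.IH(2)) (simp add: Seq.prems)
  ultimately show ?case by simp
next
  case (Loop r p)
  have "implements cd p (Suc a) a" by (rule Loop.IH) (simp add: Loop.prems)
  then show ?case using Loop.prems[of a] by simp
qed simp

lemma flat_bounds:
  "a \<le> x \<Longrightarrow> x < a + program_size p \<Longrightarrow> k < N \<Longrightarrow> a + program_size p \<le> N \<Longrightarrow>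
    (case flat p a k x of FInc r k' \<Rightarrow> r \<le> max_register p \<and> k' < N
     | FDec r y z \<Rightarrow> r \<le> max_register p \<and> y < N \<and> z < N)"
proof (induction p arbitrary: a k)
  case (Seq p q)
  show ?case
  proof (cases "x < a + program_size p")
    case True
    have "a + program_size p < N" using Seq.prems program_size_pos[of q] by simp
    then show ?thesis using Seq.IH(1)[of a "a + program_size p"] Seq.prems True
      by (auto split: counter_instr.splits)
  next
    case False
    then show ?thesis using Seq.IH(2)[of "a + program_size p" k] Seq.prems
      by (auto split: counter_instr.splits)
  qed
next
  case (Loop r p)
  show ?case
  proof (cases "x = a")
    case True
    then show ?thesis using Loop.prems program_size_pos[of p] by simp
  next
    case False
    then show ?thesis using Loop.IH[of "Suc a" a] Loop.prems
      by (auto split: counter_instr.splits)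
  qed
qed auto

text \<open>Letter \<open>2\<close> is an end marker and letter \<open>r + 3\<close> stands for one unit of register \<open>r\<close>; the order
  of the letters is immaterial. In state \<open>(a, j, l)\<close> the machine is at address \<open>a\<close>, has seen \<open>j\<close>
  end markers while looking for a unit of the register to decrement, and is about to put back the
  letter \<open>l\<close> unless \<open>l = 0\<close>.\<close>

fun queue_code :: "(nat \<Rightarrow> counter_instr) \<Rightarrow> qstate \<Rightarrow> qinstr" where
  "queue_code cd (a, j, l) = (case cd a of
     FInc r k \<Rightarrow> Push (r + 3) (k, 0, 0)
   | FDec r y z \<Rightarrow>
       if l = 0 then Pop (\<lambda>b. if b = r + 3 then (y, 0, 0) else (a, j, b))
       else Push l (if l \<noteq> 2 then (a, j, 0) else if j = 0 then (a, 1, 0) else (z, 0, 0)))"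

text \<open>Address 0 is left out as the halting address, and the letter 1 because this value is the
  separator.\<close>

definition queue_states :: "nat \<Rightarrow> nat \<Rightarrow> qstate set" where
  "queue_states N K = {(a, j, l). 0 < a \<and> a < N \<and> j < 2 \<and> (l = 0 \<or> 2 \<le> l) \<and> l < K}"

section \<open>Counters in a queue\<close>

locale counter_machine =
  fixes cd :: "nat \<Rightarrow> counter_instr" and N K :: nat
  assumes K3: "2 < K"
    and bounds: "\<And>a. 0 < a \<Longrightarrow> a < N \<Longrightarrow> (case cd a of FInc r k \<Rightarrow> r + 3 < K \<and> k < N
      | FDec r y z \<Rightarrow> r + 3 < K \<and> y < N \<and> z < N)"
begin

sublocale queue_machine K "queue_states N K" "queue_code cd"
proof
  have "queue_states N K \<subseteq> {..<N} \<times> {..<2} \<times> {..<K}" unfolding queue_states_def by auto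
  then show "finite (queue_states N K)" by (rule finite_subset) simp
next
  fix q b q'
  assume q: "q \<in> queue_states N K" and code: "queue_code cd q = Push b q'"
  obtain a j l where "q = (a, j, l)" by (cases q) auto
  then show "2 \<le> b \<and> b < K \<and> q' \<in> insert (0, 0, 0) (queue_states N K)"
    using q code bounds[of a] K3
    by (auto simp: queue_states_def split: counter_instr.splits if_splits)
next
  fix q f b
  assume q: "q \<in> queue_states N K" and code: "queue_code cd q = Pop f" and b: "2 \<le> b" "b < K"
  obtain a j l where "q = (a, j, l)" by (cases q) auto
  then show "f b \<in> insert (0, 0, 0) (queue_states N K)"
    using q code bounds[of a] b K3
    by (auto simp: queue_states_def split: counter_instr.splits if_splits)
qed (use K3 in \<open>auto simp: queue_states_def\<close>)

definition represents :: "(nat \<Rightarrow> nat) \<Rightarrow> nat list \<Rightarrow> bool" where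
  "represents s w \<longleftrightarrow> letters w \<and> count_list w 2 = 1 \<and> (\<forall>r. r + 3 < K \<longrightarrow> count_list w (r + 3) = s r)"

abbreviation at_address :: "nat \<Rightarrow> qstate" where
  "at_address a \<equiv> (a, 0, 0)"

lemma step_inc:
  assumes "0 < a" "a < N" "cd a = FInc r k" "represents s w"
  shows "\<exists>w'. qstep\<^sup>+\<^sup>+ (at_address a, w) (at_address k, w') \<and> represents (s(r := Suc (s r))) w'"
proof -
  have "qstep (at_address a, w) (at_address k, w @ [r + 3])"
    using assms K3 by (intro qstep.push) (auto simp: queue_states_def)
  moreover have "represents (s(r := Suc (s r))) (w @ [r + 3])"
    using assms bounds[of a] unfolding represents_def by auto
  ultimately show ?thesis by blast
qed

context
  fixes a r y z
  assumes a: "0 < a" "a < N" and cd: "cd a = FDec r y z"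
begin

lemma step_other:
  assumes "j < 2" "2 \<le> b" "b < K" "b \<noteq> r + 3"
  shows "qstep\<^sup>*\<^sup>* ((a, j, 0), b # w)
    (if b \<noteq> 2 then (a, j, 0) else if j = 0 then (a, 1, 0) else (z, 0, 0), w @ [b])"
proof -
  have "qstep ((a, j, 0), b # w) ((\<lambda>b. if b = r + 3 then (y, 0, 0) else (a, j, b)) b, w)"
    using assms a cd by (intro qstep.pop) (auto simp: queue_states_def)
  moreover have "qstep ((a, j, b), w)
    (if b \<noteq> 2 then (a, j, 0) else if j = 0 then (a, 1, 0) else (z, 0, 0), w @ [b])"
    using assms a cd by (intro qstep.push) (auto simp: queue_states_def)
  ultimately show ?thesis using assms(4) by (simp add: converse_rtranclp_into_rtranclp)
qed

lemma step_found:
  assumes "j < 2"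
  shows "qstep ((a, j, 0), (r + 3) # w) ((y, 0, 0), w)"
proof -
  have "qstep ((a, j, 0), (r + 3) # w) ((\<lambda>b. if b = r + 3 then (y, 0, 0) else (a, j, b)) (r + 3), w)"
    using assms a cd K3 by (intro qstep.pop) (auto simp: queue_states_def)
  then show ?thesis by simp
qed

lemma rotate:
  assumes "j < 2" "letters v" "2 \<notin> set v" "r + 3 \<notin> set v"
  shows "qstep\<^sup>*\<^sup>* ((a, j, 0), v @ w) ((a, j, 0), w @ v)"
  using assms(2-)
proof (induction v arbitrary: w)
  case (Cons b v)
  have "qstep\<^sup>*\<^sup>* ((a, j, 0), (b # v) @ w) ((a, j, 0), v @ (w @ [b]))"
    using step_other[of j b "v @ w"] assms(1) Cons.prems by auto
  also have "qstep\<^sup>*\<^sup>* \<dots> ((a, j, 0), (w @ [b]) @ v)"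
    using Cons.IH[of "w @ [b]"] Cons.prems by simp
  finally show ?case by simp
qed simp

lemma marker:
  "qstep\<^sup>*\<^sup>* ((a, 0, 0), 2 # w) ((a, 1, 0), w @ [2])" "qstep\<^sup>*\<^sup>* ((a, 1, 0), 2 # w) ((z, 0, 0), w @ [2])"
  using step_other[of 0 2 w] step_other[of 1 2 w] K3 by auto

lemma step_dec:
  assumes "represents s w" "s r = Suc m"
  shows "\<exists>w'. qstep\<^sup>+\<^sup>+ (at_address a, w) (at_address y, w') \<and> represents (s(r := m)) w'"
proof -
  have rK: "r + 3 < K" using bounds[OF a] cd by simp
  then have "count_list w (r + 3) = Suc m" using assms unfolding represents_def by simp
  then have "r + 3 \<in> set w" by (metis count_notin nat.simps(3))
  then obtain v u where w: "w = v @ (r + 3) # u" and v: "r + 3 \<notin> set v"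
    by (meson split_list_first)
  have letters: "letters v" using assms(1) unfolding represents_def w by auto
  \<comment> \<open>If the marker lies before the first unit, it is met once on the way and the unit
    is found with \<open>j = 1\<close>. In both cases the new queue is a rotation of the old one
    without that unit.\<close>
  obtain w' where w': "qstep\<^sup>+\<^sup>+ (at_address a, w) (at_address y, w')" "mset w' = mset (v @ u)"
  proof (cases "2 \<in> set v")
    case False
    have "qstep\<^sup>*\<^sup>* (at_address a, w) (at_address a, (r + 3) # u @ v)"
      using rotate[of 0 v "(r + 3) # u"] letters False v unfolding w by simp
    moreover have "qstep (at_address a, (r + 3) # u @ v) (at_address y, u @ v)"
      by (rule step_found) simp
    ultimately have "qstep\<^sup>+\<^sup>+ (at_address a, w) (at_address y, u @ v)"
      by (rule rtranclp_into_tranclp1)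
    then show ?thesis by (rule that) (simp add: union_commute)
  next
    case True
    then obtain v1 v2 where v12: "v = v1 @ 2 # v2" "2 \<notin> set v1" by (meson split_list_first)
    have "count_list w 2 = 1" using assms(1) unfolding represents_def by simp
    then have "2 \<notin> set v2" unfolding w v12 by (simp add: count_list_0_iff)
    then have "qstep\<^sup>*\<^sup>* ((a, 1, 0), v2 @ ((r + 3) # u @ v1 @ [2])) ((a, 1, 0), ((r + 3) # u @ v1 @ [2]) @ v2)"
      using letters v unfolding v12 by (intro rotate) auto
    moreover have "qstep\<^sup>*\<^sup>* ((a, 0, 0), w) ((a, 0, 0), 2 # v2 @ ((r + 3) # u) @ v1)"
      using rotate[of 0 v1 "2 # v2 @ (r + 3) # u"] letters v v12 unfolding w v12 by simp
    moreover have "qstep\<^sup>*\<^sup>* ((a, 0, 0), 2 # v2 @ ((r + 3) # u) @ v1) ((a, 1, 0), v2 @ ((r + 3) # u @ v1 @ [2]))"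
      using marker(1)[of "v2 @ ((r + 3) # u) @ v1"] by simp
    ultimately have "qstep\<^sup>*\<^sup>* ((a, 0, 0), w) ((a, 1, 0), (r + 3) # u @ v1 @ [2] @ v2)"
      by simp
    moreover have "qstep ((a, 1, 0), (r + 3) # u @ v1 @ [2] @ v2) (at_address y, u @ v1 @ [2] @ v2)"
      by (rule step_found) simp
    ultimately have "qstep\<^sup>+\<^sup>+ (at_address a, w) (at_address y, u @ v1 @ [2] @ v2)"
      by (rule rtranclp_into_tranclp1)
    then show ?thesis by (rule that) (simp add: v12)
  qed
  have "count_list w' l = count_list (v @ u) l" for l using w'(2) by (metis count_mset)
  moreover have "set w' = set (v @ u)" using w'(2) by (metis set_mset_mset)
  ultimately have "represents (s(r := m)) w'"
    using assms unfolding represents_def w by auto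
  then show ?thesis using w'(1) by blast
qed

text \<open>The marker may be anywhere when the search starts, so its first sighting proves nothing.
  Between the first and the second one every other letter is inspected, and no unit has been
  found.\<close>

lemma step_zero:
  assumes "represents s w" "s r = 0"
  shows "\<exists>w'. qstep\<^sup>*\<^sup>* (at_address a, w) (at_address z, w') \<and> represents s w'"
proof -
  have rK: "r + 3 < K" using bounds[OF a] cd by simp
  have w: "count_list w (r + 3) = 0" "count_list w 2 = 1" "letters w"
    using assms rK unfolding represents_def by auto
  then have "2 \<in> set w" by (metis count_notin zero_neq_one)
  then obtain v u where vu: "w = v @ 2 # u" "2 \<notin> set v" by (meson split_list_first)
  have 2: "2 \<notin> set u" using w(2) unfolding vu by (simp add: count_list_0_iff)
  have r: "r + 3 \<notin> set v" "r + 3 \<notin> set u" using w(1) unfolding vu count_list_0_iff by auto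
  have "qstep\<^sup>*\<^sup>* ((a, 0, 0), w) ((a, 0, 0), 2 # u @ v)"
    using rotate[of 0 v "2 # u"] w r vu by simp
  also have "qstep\<^sup>*\<^sup>* \<dots> ((a, 1, 0), u @ v @ [2])" using marker(1)[of "u @ v"] by simp
  also have "qstep\<^sup>*\<^sup>* \<dots> ((a, 1, 0), v @ [2] @ u)"
    using rotate[of 1 u "v @ [2]"] w r 2 vu by simp
  also have "qstep\<^sup>*\<^sup>* \<dots> ((a, 1, 0), 2 # u @ v)"
    using rotate[of 1 v "[2] @ u"] w r vu by simp
  also have "qstep\<^sup>*\<^sup>* \<dots> ((z, 0, 0), u @ v @ [2])" using marker(2)[of "u @ v"] by simp
  finally have "qstep\<^sup>*\<^sup>* (at_address a, w) (at_address z, u @ v @ [2])" .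
  moreover have "represents s (u @ v @ [2])" using assms unfolding represents_def vu by auto
  ultimately show ?thesis by blast
qed

end

theorem exec_simulation:
  assumes "exec p s t" "implements cd p a k" "0 < a" "a + program_size p \<le> N" "represents s w"
  shows "\<exists>w'. qstep\<^sup>*\<^sup>* (at_address a, w) (at_address k, w') \<and> represents t w'"
  using assms
proof (induction arbitrary: a k w)
  case (inc r s)
  then have "0 < a" "a < N" "cd a = FInc r k" "represents s w" by auto
  from step_inc[OF this] show ?case by (meson tranclp_into_rtranclp)
next
  case (seq p s t q u)
  let ?b = "a + program_size p"
  obtain w1 where w1: "qstep\<^sup>*\<^sup>* (at_address a, w) (at_address ?b, w1)" "represents t w1"
    using seq.IH(1)[of a ?b w] seq.prems by auto
  obtain w2 where "qstep\<^sup>*\<^sup>* (at_address ?b, w1) (at_address k, w2)" "represents u w2"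
    using seq.IH(2)[of ?b k w1] seq.prems w1(2) by auto
  then show ?case using w1(1) by (meson rtranclp_trans)
next
  case (stop s r p)
  then show ?case using step_zero[of a r "Suc a" k s w] by auto
next
  case (iter s r m p t u)
  have cd: "cd a = FDec r (Suc a) k" and impl: "implements cd p (Suc a) a" and aN: "a < N"
    using iter.prems by auto
  obtain w1 where w1: "qstep\<^sup>+\<^sup>+ (at_address a, w) (at_address (Suc a), w1)" "represents (s(r := m)) w1"
    using step_dec[OF iter.prems(2) aN cd iter.prems(4) iter.hyps(1)] by blast
  obtain w2 where w2: "qstep\<^sup>*\<^sup>* (at_address (Suc a), w1) (at_address a, w2)" "represents t w2"
    using iter.IH(1)[OF impl _ _ w1(2)] iter.prems by auto
  obtain w3 where "qstep\<^sup>*\<^sup>* (at_address a, w2) (at_address k, w3)" "represents u w3"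
    using iter.IH(2)[OF iter.prems(1-3) w2(2)] by blast
  then show ?case using w1(1) w2(1) by (meson rtranclp_trans tranclp_into_rtranclp)
qed

lemma qstep_deterministic: "qstep c c1 \<Longrightarrow> qstep c c2 \<Longrightarrow> c1 = c2"
  by (auto elim!: qstep.cases)

text \<open>One turn decrements \<open>r\<close> and increments it again, returning to the head of
  the loop with a nonzero register. By \<open>never_reaches_final\<close> such a recurrence excludes
  halting.\<close>

theorem busy_loop:
  assumes impl: "implements cd (Loop r (Inc r)) a k" and a: "0 < a" "Suc a < N"
    and run: "qstep\<^sup>*\<^sup>* c (at_address a, w)" and s: "represents s w" "s r \<noteq> 0"
  shows "\<not> qstep\<^sup>*\<^sup>* c ((0, 0, 0), w')"
proof (rule never_reaches_final[where X = "{(at_address a, w) | s w. represents s w \<and> s r \<noteq> 0}"])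
  show "(at_address a, w) \<in> {(at_address a, w) | s w. represents s w \<and> s r \<noteq> 0}" using s by blast
  show "\<not> qstep ((0, 0, 0), w') c'" for c' using halt by (auto elim: qstep.cases)
  fix x
  assume "x \<in> {(at_address a, w) | s w. represents s w \<and> s r \<noteq> 0}"
  then obtain s w where x: "x = (at_address a, w)" and s: "represents s w" "s r \<noteq> 0" by blast
  then obtain m where m: "s r = Suc m" by (cases "s r") auto
  have cd: "cd a = FDec r (Suc a) k" "cd (Suc a) = FInc r a" using impl by auto
  obtain w1 where w1: "qstep\<^sup>+\<^sup>+ x (at_address (Suc a), w1)" "represents (s(r := m)) w1"
    using step_dec[OF a(1) _ cd(1) s(1) m] a(2) x by auto
  obtain w2 where w2: "qstep\<^sup>+\<^sup>+ (at_address (Suc a), w1) (at_address a, w2)"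
      "represents ((s(r := m))(r := Suc ((s(r := m)) r))) w2"
    using step_inc[OF _ a(2) cd(2) w1(2)] by auto
  have "\<exists>s. represents s w2 \<and> s r \<noteq> 0" using w2(2) by (intro exI) auto
  then show "\<exists>y\<in>{(at_address a, w) | s w. represents s w \<and> s r \<noteq> 0}. qstep\<^sup>+\<^sup>+ x y"
    using w1(1) w2(1) by (intro bexI[of _ "(at_address a, w2)"]) auto
qed (use run qstep_deterministic in auto)

end

section \<open>Diagonalisation\<close>

fun rec_const :: "nat \<Rightarrow> recf" where
  "rec_const 0 = Zero"
| "rec_const (Suc c) = Comp Succ [rec_const c]"

definition "rec_add = PrimRec (Proj 0) (Comp Succ [Proj 1])"
definition "rec_triangle = PrimRec Zero (Comp rec_add [Comp Succ [Proj 0], Proj 1])"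
text \<open>Cantor pairing as in \<open>prod_encode\<close>: the triangular number of
  \<open>m + n\<close>, plus \<open>m\<close>.\<close>

definition "rec_pair = Comp rec_add [Comp rec_triangle [rec_add], Proj 0]"
definition "rec_cons = Comp Succ [rec_pair]"

fun rec_list :: "recf list \<Rightarrow> recf" where
  "rec_list [] = Zero"
| "rec_list (h # hs) = Comp rec_cons [h, rec_list hs]"

lemma computes_Comp1:
  "computes g xs y \<Longrightarrow> computes f [y] z \<Longrightarrow> computes (Comp f [g]) xs z"
  by (rule computes.intros(4)[of _ _ "[y]"]) auto

lemma computes_Comp2:
  "computes g xs y \<Longrightarrow> computes h xs y' \<Longrightarrow> computes f [y, y'] z \<Longrightarrow> computes (Comp f [g, h]) xs z"
  by (rule computes.intros(4)[of _ _ "[y, y']"]) auto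

lemma computes_Proj': "k < length xs \<Longrightarrow> xs ! k = y \<Longrightarrow> computes (Proj k) xs y"
  using computes.intros(3) by blast

lemma computes_const: "computes (rec_const c) xs c"
  by (induction c) (auto intro: computes.intros(1,2) computes_Comp1)

lemma computes_add: "computes rec_add [m, n] (m + n)"
  unfolding rec_add_def
proof (induction m)
  case 0
  show ?case by (auto intro!: computes.intros(5) computes_Proj')
next
  case (Suc m)
  have "computes (Comp Succ [Proj 1]) [m, m + n, n] (Suc (m + n))"
    by (rule computes_Comp1[OF computes_Proj' computes.intros(2)]) auto
  with Suc show ?case using computes.intros(6) by fastforce
qed

lemma computes_triangle: "computes rec_triangle [n] (triangle n)"
  unfolding rec_triangle_def
proof (induction n)
  case 0
  show ?case by (auto intro!: computes.intros(1,5))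
next
  case (Suc n)
  have "computes (Comp rec_add [Comp Succ [Proj 0], Proj 1]) [n, triangle n] (Suc n + triangle n)"
    by (rule computes_Comp2[OF computes_Comp1[OF computes_Proj' computes.intros(2)] computes_Proj' computes_add])
      auto
  with Suc show ?case using computes.intros(6) by (fastforce simp: add.commute)
qed

lemma computes_pair: "computes rec_pair [m, n] (prod_encode (m, n))"
  unfolding rec_pair_def prod_encode_def prod.case
  by (rule computes_Comp2[OF computes_Comp1[OF computes_add computes_triangle] computes_Proj' computes_add])
    auto

lemma computes_cons: "computes rec_cons [x, list_encode xs] (list_encode (x # xs))"
  unfolding rec_cons_def list_encode.simps by (rule computes_Comp1[OF computes_pair computes.intros(2)])

lemma computes_list:
  "list_all2 (\<lambda>h y. computes h xs y) hs ys \<Longrightarrow> computes (rec_list hs) xs (list_encode ys)"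
proof (induction rule: list_all2_induct)
  case Nil
  then show ?case by (simp add: computes.intros(1))
next
  case (Cons h hs y ys)
  then show ?case unfolding rec_list.simps by (intro computes_Comp2[OF _ _ computes_cons])
qed

text \<open>The end marker is the oldest letter of the queue; it is followed by the input in unary.\<close>

definition input_buffer :: "nat \<Rightarrow> (nat \<times> nat) list" where
  "input_buffer n = concat (replicate n [(1, 1), (0, 3)]) @ [(1, 1), (0, 2)]"

lemma input_buffer_items: "input_buffer n = rev (items (2 # replicate n 3))"
proof (induction n)
  case (Suc n)
  have eq: "2 # replicate (Suc n) 3 = (2 # replicate n 3) @ [3 :: nat]"
    by (simp add: replicate_append_same)
  have "input_buffer (Suc n) = rev (items [3]) @ input_buffer n"
    by (simp add: input_buffer_def)
  also have "\<dots> = rev (items (2 # replicate n 3) @ items [3])" unfolding Suc by simp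
  finally show ?case unfolding eq items_simps(3) .
qed (simp add: input_buffer_def)

text \<open>The writer starts at address 1 because address 0 means halting, and variable 2 starts at
  1 as if a separator had just been forwarded.\<close>

definition instance_for ::
  "(nat list \<times> (nat \<times> (nat, nat) instr \<times> nat) list) list \<Rightarrow> nat \<Rightarrow> tso_instance" where
  "instance_for ps n = \<lparr>n_vars = 3, n_vals = n, proc_list = ps, target_list = [0],
     init_st = [writer_code (1, 0, 0) 0, relay_code (Chk 0)], init_buf = [input_buffer n, []],
     init_mem = [0, 0, 1]\<rparr>"

text \<open>Buffers are listed newest first, so one more unit of input prepends two messages, which
  suits primitive recursion on \<open>n\<close>.\<close>

definition rec_buffer :: recf where
  "rec_buffer = PrimRec (rec_const (list_encode (map prod_encode (input_buffer 0))))
     (Comp rec_cons [rec_const (prod_encode (1, 1)), Comp rec_cons [rec_const (prod_encode (0, 3)), Proj 1]])"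

lemma computes_buffer: "computes rec_buffer [n] (list_encode (map prod_encode (input_buffer n)))"
  unfolding rec_buffer_def
proof (induction n)
  case 0
  show ?case by (intro computes.intros(5) computes_const)
next
  case (Suc n)
  let ?l = "map prod_encode (input_buffer n)"
  have "computes (Comp rec_cons [rec_const (prod_encode (1, 1)),
      Comp rec_cons [rec_const (prod_encode (0, 3)), Proj 1]]) [n, list_encode ?l]
      (list_encode (prod_encode (1, 1) # prod_encode (0, 3) # ?l))"
    by (rule computes_Comp2[OF computes_const computes_Comp2[OF computes_const computes_Proj' computes_cons]
        computes_cons]) auto
  moreover have "map prod_encode (input_buffer (Suc n)) = prod_encode (1, 1) # prod_encode (0, 3) # ?l"
    by (simp add: input_buffer_def)
  ultimately show ?case using computes.intros(6)[OF Suc] by simp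
qed

definition "rec_buffers = rec_list [rec_buffer, Zero]"

definition rec_instance :: recf where
  "rec_instance = rec_list [rec_const 3, Proj 0, Proj 0, rec_const (list_encode [0]),
     rec_const (list_encode [writer_code (1, 0, 0) 0, relay_code (Chk 0)]),
     rec_buffers, rec_const (list_encode [0, 0, 1])]"

text \<open>The program code is the value bound as well as the input, so that the recursive function has
  no need to inspect it.\<close>

lemma computes_instance:
  assumes "list_encode (map code_process ps) = n"
  shows "computes rec_instance [n] (code_instance (instance_for ps n))"
proof -
  let ?buffers = "list_encode [list_encode (map prod_encode (input_buffer n)), list_encode (map prod_encode [])]"
  have "list_all2 (\<lambda>h y. computes h [n] y) [rec_buffer, Zero]
      [list_encode (map prod_encode (input_buffer n)), list_encode (map prod_encode [])]"
    using computes_buffer[of n] computes.intros(1)[of "[n]"] by simp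
  then have "computes rec_buffers [n] ?buffers"
    unfolding rec_buffers_def by (rule computes_list)
  then have "list_all2 (\<lambda>h y. computes h [n] y) [rec_const 3, Proj 0, Proj 0, rec_const (list_encode [0]),
      rec_const (list_encode [writer_code (1, 0, 0) 0, relay_code (Chk 0)]), rec_buffers,
      rec_const (list_encode [0, 0, 1])]
      [3, n, n, list_encode [0], list_encode [writer_code (1, 0, 0) 0, relay_code (Chk 0)], ?buffers,
       list_encode [0, 0, 1]]"
    by (intro list_all2_Cons[THEN iffD2] conjI list_all2_Nil[THEN iffD2] computes_const
        computes_Proj') simp_all
  moreover have "code_instance (instance_for ps n) = list_encode [3, n, n, list_encode [0],
      list_encode [writer_code (1, 0, 0) 0, relay_code (Chk 0)], ?buffers, list_encode [0, 0, 1]]"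
    unfolding code_instance_def instance_for_def by (simp add: assms del: list_encode.simps)
  ultimately show ?thesis unfolding rec_instance_def by (simp only: computes_list)
qed

lemma count_list_replicate: "count_list (replicate n x) y = (if x = y then n else 0)"
  by (induction n) auto

lemma less_list_encode: "x \<in> set xs \<Longrightarrow> x < list_encode xs"
proof (induction xs)
  case (Cons y ys)
  have "y \<le> prod_encode (y, list_encode ys)" "list_encode ys \<le> prod_encode (y, list_encode ys)"
    by (rule le_prod_encode_1, rule le_prod_encode_2)
  then show ?case using Cons by auto
qed simp

text \<open>Any enumeration will do: once chosen, the code of the resulting list is a fixed
  number.\<close>

definition list_of :: "'a set \<Rightarrow> 'a list" where
  "list_of A = (SOME xs. set xs = A)"

lemma set_list_of: "finite A \<Longrightarrow> set (list_of A) = A"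
  unfolding list_of_def by (rule someI_ex[OF finite_list])

lemma finite_instrs: "finite X \<Longrightarrow> finite V \<Longrightarrow> finite (instrs X V)"
proof -
  assume "finite X" "finite V"
  moreover have "instrs X V = case_prod Rd ` (X \<times> V) \<union> case_prod Wr ` (X \<times> V) \<union> {Skip, Mf}"
    unfolding instrs_def by auto
  ultimately show ?thesis by simp
qed

text \<open>The final loop puts back what it takes from register 1, so it ends only if the result
  there is zero. Register 0 holds the input, and the registers from 2 on are scratch.\<close>

definition halting_iff_zero :: "recf \<Rightarrow> loop_program" where
  "halting_iff_zero g = Seq (compile g [0] 1 2) (Loop 1 (Inc 1))"

section \<open>The instance built from a recursive function\<close>

locale compiled =
  fixes g :: recf
begin

abbreviation "addresses \<equiv> Suc (program_size (halting_iff_zero g))"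

abbreviation "alphabet \<equiv> max_register (halting_iff_zero g) + 4"

abbreviation "flat_code \<equiv> flat (halting_iff_zero g) 1 0"

sublocale counter_machine flat_code addresses alphabet
proof
  fix a
  assume a: "0 < a" "a < addresses"
  show "case flat_code a of FInc r k \<Rightarrow> r + 3 < alphabet \<and> k < addresses
      | FDec r y z \<Rightarrow> r + 3 < alphabet \<and> y < addresses \<and> z < addresses"
    using flat_bounds[of 1 a "halting_iff_zero g" 0 addresses] a
    by (auto split: counter_instr.splits)
qed simp

definition processes :: "(nat list \<times> (nat \<times> (nat, nat) instr \<times> nat) list) list" where
  "processes = [(list_of writer_states, list_of writer_trans),
     (list_of (relay_states alphabet), list_of (relay_trans alphabet))]"

text \<open>The processes depend on \<open>g\<close> but not on the input of its program, so their
  code is available before that input is fixed.\<close>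

definition self :: nat where
  "self = list_encode (map code_process processes)"

abbreviation "inst \<equiv> instance_for processes self"

lemma finite_writer_trans: "finite writer_trans"
  by (rule finite_subset[OF writer_trans_subset[OF order_refl]])
    (intro finite_cartesian_product finite_writer_states finite_instrs finite_lessThan)

lemma finite_relay_trans: "finite (relay_trans alphabet)"
  by (rule finite_subset[OF relay_trans_subset[OF order_refl]])
    (simp_all add: finite_relay_states finite_instrs)

lemma program_of_inst:
  "vars (program_of inst) = {..<3}" "vals (program_of inst) = {..<self}"
  "procs (program_of inst) = {..<2}"
  "states (program_of inst) 0 = writer_states" "trans_rel (program_of inst) 0 = writer_trans"
  "states (program_of inst) 1 = relay_states alphabet"
  "trans_rel (program_of inst) 1 = relay_trans alphabet"
  using set_list_of[OF finite_writer_states] set_list_of[OF finite_writer_trans]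
    set_list_of[OF finite_relay_states] set_list_of[OF finite_relay_trans]
  by (simp_all add: program_of_def instance_for_def processes_def numeral_2_eq_2)

text \<open>The largest letter occurs in an alarm transition of the relay, and each level of the
  coding exceeds the entries it encodes. So the code of the program is large enough to bound its own
  values.\<close>

lemma alphabet_le_self: "alphabet \<le> self"
proof -
  let ?d = "alphabet - 1"
  have "relay_step alphabet (Chk 0) (Rd 0 ?d) Target"
    by (rule relay_step.alarm) auto
  then have "(relay_code (Chk 0), Rd 0 ?d, relay_code Target) \<in> relay_trans alphabet"
    by (rule relay_transI)
  then have t: "(relay_code (Chk 0), Rd 0 ?d, relay_code Target) \<in> set (list_of (relay_trans alphabet))"
    using set_list_of finite_relay_trans by blast
  let ?t = "code_trans (relay_code (Chk 0), Rd 0 ?d, relay_code Target)"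
  let ?p = "(list_of (relay_states alphabet), list_of (relay_trans alphabet))"
  have "?d < code_instr (Rd 0 ?d)" unfolding code_instr.simps by (rule less_list_encode) simp
  also have "\<dots> < ?t" unfolding code_trans.simps by (rule less_list_encode) simp
  also have "\<dots> < list_encode (map code_trans (list_of (relay_trans alphabet)))"
    using t by (intro less_list_encode) (metis image_eqI list.set_map)
  also have "\<dots> < code_process ?p" unfolding code_process.simps by (rule less_list_encode) simp
  also have "\<dots> < self" unfolding self_def processes_def by (rule less_list_encode) simp
  finally show ?thesis by simp
qed

lemma program: "program (program_of inst)"
proof -
  have "writer_trans \<subseteq> writer_states \<times> instrs {..<3} {..<self} \<times> writer_states"
    by (rule writer_trans_subset[OF alphabet_le_self])
  moreover have "relay_trans alphabet \<subseteq>
      relay_states alphabet \<times> instrs {..<3} {..<self} \<times> relay_states alphabet"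
    using alphabet_le_self by (intro relay_trans_subset) simp_all
  ultimately have "finite (states (program_of inst) i) \<and> trans_rel (program_of inst) i \<subseteq>
      states (program_of inst) i \<times> instrs {..<3} {..<self} \<times> states (program_of inst) i"
    if "i < 2" for i
    using that unfolding less_2_iff
    by (elim disjE) (simp_all only: program_of_inst finite_writer_states finite_relay_states simp_thms)
  then show ?thesis unfolding program_def program_of_inst(1-3) by blast
qed

sublocale relay_program alphabet writer_trans "program_of inst"
  using program program_of_inst writer_trans_cases by unfold_locales auto

sublocale safe_writer alphabet writer_trans "program_of inst" safe_writer_state
  using safe_basic safe_send safe_get safe_deliver by unfold_locales

abbreviation "start \<equiv> init_of inst"

lemma init:
  "st start 0 = writer_code (1, 0, 0) 0" "st start 1 = relay_code (Chk 0)"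
  "buf start 0 = rev (items (2 # replicate self 3))" "buf start 1 = []"
  "mem start 0 = 0" "mem start 1 = 0" "mem start 2 = 1"
  unfolding init_of_def instance_for_def input_buffer_items by simp_all

lemma start_state: "(1, 0, 0) \<in> queue_states addresses alphabet"
  using program_size_pos[of "halting_iff_zero g"] by (simp add: queue_states_def)

lemma start_configs: "start \<in> configs (program_of inst)"
proof -
  have "st start 0 \<in> writer_states"
    unfolding init using start_state by (intro writer_statesI) auto
  moreover have "st start 1 \<in> relay_states alphabet" unfolding init relay_states_mem by simp
  moreover have "set (buf start 0) \<subseteq> {..<3} \<times> {..<self}"
    using alphabet_le_self unfolding init items_def by auto
  moreover have mem: "mem start x \<in> {..<self}" if "x < 3" for x
  proof -
    have "x = 0 \<or> x = 1 \<or> x = 2" using that by auto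
    then show ?thesis using init alphabet_le_self by auto
  qed
  ultimately have "st start i \<in> states (program_of inst) i \<and> set (buf start i) \<subseteq> {..<3} \<times> {..<self}"
    if "i < 2" for i
    using that program_of_inst(4,6) init(4) unfolding less_2_iff by (elim disjE) simp_all
  then show ?thesis
    using mem unfolding configs_def program_of_inst(1-3) by blast
qed

lemma target_sink:
  assumes "(0, ins, q) \<in> trans_rel (program_of inst) i" "i < 2"
  shows "q = 0"
proof -
  have "i = 0 \<or> i = 1" using assms(2) by auto
  then show ?thesis
  proof
    assume "i = 0"
    then have "(0, ins, q) \<in> writer_trans" using assms(1) program_of_inst by simp
    then show ?thesis using halt K_gt by cases auto
  next
    assume "i = 1"
    then have "(relay_code Target, ins, q) \<in> relay_trans alphabet"
      using assms(1) program_of_inst by simp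
    then show ?thesis unfolding relay_trans_source by (auto elim: relay_step.cases)
  qed
qed

text \<open>Neither process can leave state 0, and its skip to itself is enabled whatever the
  buffers and the memory contain.\<close>

lemma no_deadlock: "no_deadlock_from_target (program_of inst) {0}"
  unfolding no_deadlock_from_target_def
proof (intro ballI impI allI)
  fix c i c'
  assume i: "i \<in> procs (program_of inst)" and st: "st c i \<in> {0}"
    and steps: "(tso_step (program_of inst))\<^sup>*\<^sup>* c c'"
  have i2: "i < 2" using i program_of_inst by simp
  have step: "st d' i = 0" if "tso_step (program_of inst) d d'" "st d i = 0" for d d'
    using that target_sink[OF _ i2] unfolding tso_step_def
    by (auto elim!: instr_step.cases update_step.cases)
  have "st c' i = 0" using steps st by induction (auto intro: step)
  moreover have "i = 0 \<or> i = 1" using i2 by auto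
  moreover have "(0, Skip, 0) \<in> relay_trans alphabet"
    using relay_transI[OF relay_step.target] by simp
  ultimately have "(st c' i, Skip, 0) \<in> trans_rel (program_of inst) i"
    using program_of_inst writer_trans.intros(5) by auto
  then show "\<exists>c''. instr_step (program_of inst) i c' c''"
    using instr_step.skip[OF i] by (intro exI)
qed

lemma targets: "targets_of inst = {0}"
  by (simp add: targets_of_def instance_for_def)

lemma valid: "valid_instance inst"
proof -
  have "(\<Union>i\<in>procs (program_of inst). states (program_of inst) i) \<supseteq> {0}"
    using program_of_inst(3,4) writer_statesI(1) by (metis UN_I empty_subsetI insert_subsetI lessThan_iff zero_less_numeral)
  moreover have "st start 0 \<noteq> 0" "st start 1 \<noteq> 0" unfolding init by auto
  then have "\<not> in_target (program_of inst) {0} start"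
    unfolding in_target_def by (auto simp: program_of_inst less_2_iff)
  ultimately show ?thesis
    unfolding valid_instance_def targets
    using program start_configs no_deadlock by (simp add: instance_for_def processes_def)
qed

definition registers :: "nat \<Rightarrow> nat" where
  "registers r = (if r = 0 then self else 0)"

lemma represents_input: "represents registers (2 # replicate self 3)"
  unfolding represents_def registers_def by (auto simp: count_list_0_iff count_list_replicate)

lemma letters_input: "letters (2 # replicate self 3)"
  using represents_input unfolding represents_def by blast

lemma implements: "implements flat_code (halting_iff_zero g) 1 0"
  by (rule implements_flat) simp

lemma exec_compiled:
  assumes "computes g [self] y"
  shows "exec (compile g [0] 1 2) registers (registers(1 := y))"
  using correctD[OF compile_correct, of g registers "[0]" y 1 2] assms by (simp add: registers_def)

lemma winning_if_zero:
  assumes "computes g [self] 0"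
  shows "winning_for_A (tso_game (program_of inst)) (W_RU (program_of inst) {0}) (Turn_A start)"
proof -
  have "registers(1 := 0) = registers" by (auto simp: registers_def)
  then have "exec (compile g [0] 1 2) registers registers" using exec_compiled[OF assms] by simp
  moreover have "exec (Loop 1 (Inc 1)) registers registers"
    by (rule exec.stop) (simp add: registers_def)
  ultimately have "exec (halting_iff_zero g) registers registers"
    unfolding halting_iff_zero_def by (rule exec.seq)
  then obtain w' where "qstep\<^sup>*\<^sup>* (at_address 1, 2 # replicate self 3) (at_address 0, w')"
    using exec_simulation[OF _ implements _ _ represents_input] by auto
  then have "reaches_target alphabet writer_trans (writer_code (1, 0, 0) 0)
      (items (2 # replicate self 3)) 1 0"
    using halting_reaches_target letters_input by blast
  from reaches_target_wins[OF this alternating_letters[OF letters_input] zero_less_numeral]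
  obtain n where n: "\<forall>c. at_chk (writer_code (1, 0, 0) 0) (items (2 # replicate self 3)) 1 0 c
      \<longrightarrow> wins n c" by blast
  have "sound start"
    unfolding sound_def init
    using alternating_items[OF alternating_letters[OF letters_input]] by auto
  then have "at_chk (writer_code (1, 0, 0) 0) (items (2 # replicate self 3)) 1 0 start"
    unfolding at_chk_def init by simp
  then show ?thesis using n wins_within_winning[OF program start_configs] by blast
qed

lemma not_winning_if_nonzero:
  assumes "computes g [self] y" "y \<noteq> 0"
  shows "\<not> winning_for_A (tso_game (program_of inst)) (W_RU (program_of inst) {0}) (Turn_A start)"
proof -
  let ?p = "compile g [0] 1 2"
  let ?a = "1 + program_size ?p"
  have impl: "implements flat_code ?p 1 ?a" "implements flat_code (Loop 1 (Inc 1)) ?a 0"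
    using implements unfolding halting_iff_zero_def by simp_all
  have size: "program_size (halting_iff_zero g) = program_size ?p + 2" by (simp add: halting_iff_zero_def)
  obtain w where w: "qstep\<^sup>*\<^sup>* (at_address 1, 2 # replicate self 3) (at_address ?a, w)"
      "represents (registers(1 := y)) w"
    using exec_simulation[OF exec_compiled[OF assms(1)] impl(1) _ _ represents_input] size by auto
  have "\<not> qstep\<^sup>*\<^sup>* (at_address 1, 2 # replicate self 3) ((0, 0, 0), w')" for w'
    by (rule busy_loop[OF impl(2) _ _ w]) (use size assms(2) in auto)
  then have "safe (1, 0, 0) (2 # replicate self 3)"
    unfolding safe_def using start_state letters_input by blast
  then have "safe_writer_state (writer_code (1, 0, 0) 0) (items (2 # replicate self 3)) 1 0"
    by (rule safe_writer_state.intros(1))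
  then have "idle (writer_code (1, 0, 0) 0) (items (2 # replicate self 3)) 1 0 start"
    unfolding idle_def init by simp
  then show ?thesis using region_not_winning start_configs init(2) by blast
qed

end

theorem theorem3:
  shows "\<not> decidable_on code_instance {a. valid_instance a}
    (\<lambda>a. winning_for_A (tso_game (program_of a)) (W_RU (program_of a) (targets_of a))
       (Turn_A (init_of a)))"
proof
  assume "decidable_on code_instance {a. valid_instance a}
    (\<lambda>a. winning_for_A (tso_game (program_of a)) (W_RU (program_of a) (targets_of a))
       (Turn_A (init_of a)))"
  then obtain f where f: "\<And>a. valid_instance a \<Longrightarrow> computes f [code_instance a]
      (if winning_for_A (tso_game (program_of a)) (W_RU (program_of a) (targets_of a))
         (Turn_A (init_of a)) then 1 else 0)"
    unfolding decidable_on_def by blast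
  interpret compiled "Comp f [rec_instance]" .
  let ?wins = "winning_for_A (tso_game (program_of inst)) (W_RU (program_of inst) {0}) (Turn_A start)"
  have "computes rec_instance [self] (code_instance inst)"
    by (rule computes_instance) (simp add: self_def)
  then have g: "computes (Comp f [rec_instance]) [self] (if ?wins then 1 else 0)"
    using f[OF valid] unfolding targets by (rule computes_Comp1)
  \<comment> \<open>The answer 1 sends the program into its endless loop, so that the update player
    wins; the answer 0 makes it halt, so that the process player wins. Either way the answer is
    wrong.\<close>
  show False
  proof (cases ?wins)
    case True
    then show ?thesis using g not_winning_if_nonzero[of 1] by simp
  next
    case False
    then show ?thesis using g winning_if_zero by simp
  qed
qed

end
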